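(* Let $A$ generate a quasi-contractive $C_0$-semigroup $S(t)$ of type $\omega$ on the real Hilbert space $\mathcal{H}$ (i.e. $\langle Ax,x\rangle\le\omega\|x\|^2$ for all $x\in D(A)$), and let $B:\mathcal{H}\to\mathcal{H}$ be a bounded linear self-adjoint positive operator. Let $\mathcal{W}=\{x\in\mathcal{H}: BS(t)x=0\ \forall t\ge 0\}$ and let $P$ be the orthogonal projection of $\mathcal{H}$ onto $\mathcal{W}^{\perp}$ (along $\mathcal{W}$). Assume that: (i) $\mathcal{W}^{\perp}$ is invariant under $S(t)$ for all $t\ge0$; (ii) there is a function $\varphi:\mathcal{W}^{\perp}\cap D(A)\to\mathbb{R}^{+}$ such that $\langle Ay,By\rangle\le\varphi(y)\|By\|^2$ for all $y\in\mathcal{W}^{\perp}\cap D(A)$, and such that the mapping $\Upsilon:\mathcal{W}^{\perp}\cap D(A)\to\mathcal{H}$, $\Upsilon(y)=\varphi(y)By$, can be extended to a globally Lipschitz function on $\mathcal{W}^{\perp}$. Let $0<\mu<\frac12$. Then, for every $y_0\in\mathcal{H}$, the closed-loop system $$\frac{d}{dt}y(t)=Ay(t)-F(y(t)),\quad t>0,\qquad y(0)=y_0,$$ where $$F(y)=\begin{cases}\langle BPy,Py\rangle^{-\mu}By+\varphi(Py)By,& BPy\ne0,\\ 0,& BPy=0,\end{cases}$$ has a unique weak solution $y\in C([0,+\infty),\mathcal{H})$.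
   Context: $\mathcal{H}$ is a real Hilbert space with scalar product $\langle\cdot,\cdot\rangle$ and norm $\|\cdot\|$. "Positive" means $\langle Bx,x\rangle\ge0$ for all $x\in\mathcal{H}$. The closed-loop system arises from the bilinear system $\frac{d}{dt}y=Ay+u(t)By$ with the feedback $u(t)=-\big(\langle BPy(t),Py(t)\rangle^{-\mu}+\varphi(Py(t))\big)\mathbf 1_{\{BPy(t)\neq0\}}$. Since $\mathcal{W}$ is always $S(t)$-invariant, assumption (i) implies that $P$ commutes with $S(t)$ and maps $D(A)$ into $D(A)\cap\mathcal{W}^\perp$, so $F(y)$ makes sense for $y\in D(A)$. Strong solution: for $f\in L^1(0,T;\mathcal{H})$, a function $y\in C([0,T],\mathcal{H})$ is a strong solution of $\frac{d}{dt}y=Ay-F(y)+f$ on $[0,T]$ if it is absolutely continuous on every compact subset of $(0,T)$, and for a.e. $t\in(0,T)$ one has $y(t)\in D(A)$ and the equation holds at $t$. Weak solution: a function $y\in C([0,T],\mathcal{H})$ is a weak solution of $\frac{d}{dt}y=Ay-F(y)$, $y(0)=y_0$, on $[0,T]$ if $y(0)=y_0$ and there exist $f_n\in L^1(0,T;\mathcal{H})$ with $f_n\to0$ in $L^1(0,T;\mathcal{H})$ and $y_n\in C([0,T],\mathcal{H})$ such that $y_n$ is a strong solution of $\frac{d}{dt}y_n=Ay_n-F(y_n)+f_n$ and $y_n\to y$ uniformly on $[0,T]$. A weak solution on $[0,+\infty)$ is a function that is a weak solution on $[0,T]$ for every $T>0$. *)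

theory Defs
  imports "HOL-Analysis.Analysis"
begin

text \<open>
  A real Hilbert space is a type of sort \<open>{real_inner, banach}\<close>; separability is not assumed.
  An unbounded operator is a domain \<open>D\<close> together with a total function \<open>A\<close> of which only the
  values on \<open>D\<close> matter.
\<close>

definition C0_semigroup :: "(real \<Rightarrow> 'a::real_normed_vector \<Rightarrow> 'a) \<Rightarrow> bool" where
  "C0_semigroup S \<longleftrightarrow>
     (\<forall>t\<ge>0. bounded_linear (S t)) \<and>
     (\<forall>x. S 0 x = x) \<and>
     (\<forall>s\<ge>0. \<forall>t\<ge>0. \<forall>x. S (s + t) x = S s (S t x)) \<and>
     (\<forall>x. ((\<lambda>t. S t x) \<longlongrightarrow> x) (at_right 0))"

definition generates ::
  "'a::real_normed_vector set \<Rightarrow> ('a \<Rightarrow> 'a) \<Rightarrow> (real \<Rightarrow> 'a \<Rightarrow> 'a) \<Rightarrow> bool" where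
  "generates D A S \<longleftrightarrow>
     C0_semigroup S \<and>
     D = {x. \<exists>l. ((\<lambda>t. (S t x - x) /\<^sub>R t) \<longlongrightarrow> l) (at_right 0)} \<and>
     (\<forall>x\<in>D. ((\<lambda>t. (S t x - x) /\<^sub>R t) \<longlongrightarrow> A x) (at_right 0))"

text \<open>
  Quasi-contractivity of type \<open>\<omega>\<close>, expressed on the generator. When \<open>A\<close> generates \<open>S\<close>, this is
  equivalent to \<open>norm (S t x) \<le> exp (\<omega> * t) * norm x\<close> for all \<open>t \<ge> 0\<close> and all \<open>x\<close>.
\<close>

definition generates_quasi_contractive ::
  "real \<Rightarrow> 'a::real_inner set \<Rightarrow> ('a \<Rightarrow> 'a) \<Rightarrow> (real \<Rightarrow> 'a \<Rightarrow> 'a) \<Rightarrow> bool" where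
  "generates_quasi_contractive \<omega> D A S \<longleftrightarrow>
     generates D A S \<and> (\<forall>x\<in>D. A x \<bullet> x \<le> \<omega> * (norm x)\<^sup>2)"

definition selfadjoint_op :: "('a::real_inner \<Rightarrow> 'a) \<Rightarrow> bool" where
  "selfadjoint_op B \<longleftrightarrow> (\<forall>x y. B x \<bullet> y = x \<bullet> B y)"

definition positive_op :: "('a::real_inner \<Rightarrow> 'a) \<Rightarrow> bool" where
  "positive_op B \<longleftrightarrow> (\<forall>x. 0 \<le> B x \<bullet> x)"

definition unobservable ::
  "('a::real_normed_vector \<Rightarrow> 'a) \<Rightarrow> (real \<Rightarrow> 'a \<Rightarrow> 'a) \<Rightarrow> 'a set" where
  "unobservable B S = {x. \<forall>t\<ge>0. B (S t x) = 0}"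

definition projection_onto_along ::
  "('a::real_vector \<Rightarrow> 'a) \<Rightarrow> 'a set \<Rightarrow> 'a set \<Rightarrow> bool" where
  "projection_onto_along P V W \<longleftrightarrow> (\<forall>x. P x \<in> V \<and> x - P x \<in> W)"

text \<open>
  In the branch \<open>B (P y) \<noteq> 0\<close> the base of the real power is strictly positive when \<open>B\<close> is
  bounded, self-adjoint and positive, so \<open>powr\<close> is the usual power there.
\<close>

definition closed_loop_F ::
  "('a::real_inner \<Rightarrow> 'a) \<Rightarrow> ('a \<Rightarrow> 'a) \<Rightarrow> real \<Rightarrow> ('a \<Rightarrow> real) \<Rightarrow> 'a \<Rightarrow> 'a" where
  "closed_loop_F B P \<mu> \<phi> y =
     (if B (P y) \<noteq> 0
      then ((B (P y) \<bullet> P y) powr (- \<mu>)) *\<^sub>R B y + \<phi> (P y) *\<^sub>R B y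
      else 0)"

text \<open>
  Bochner's \<open>L\<^sup>1(0,T;H)\<close>. The library's \<^const>\<open>integrable\<close> needs a second-countable target type,
  which would force the Hilbert space to be separable. Hence strong measurability (a.e. limit of
  simple functions) is spelled out.
\<close>

definition L1_norm :: "real \<Rightarrow> (real \<Rightarrow> 'a::real_normed_vector) \<Rightarrow> ennreal" where
  "L1_norm T f = (\<integral>\<^sup>+t. ennreal (norm (f t)) \<partial>lebesgue_on {0<..<T})"

definition L1_fun :: "real \<Rightarrow> (real \<Rightarrow> 'a::real_normed_vector) \<Rightarrow> bool" where
  "L1_fun T f \<longleftrightarrow>
     (\<exists>s :: nat \<Rightarrow> real \<Rightarrow> 'a.
        (\<forall>i. simple_function (lebesgue_on {0<..<T}) (s i)) \<and>
        (AE t in lebesgue_on {0<..<T}. (\<lambda>i. s i t) \<longlonglongrightarrow> f t)) \<and>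
     L1_norm T f < \<infinity>"

text \<open>Pairs \<open>(a, b)\<close> in \<open>I\<close> stand for the non-overlapping intervals \<open>(a, b)\<close>.\<close>

definition abs_continuous_on :: "real set \<Rightarrow> (real \<Rightarrow> 'a::real_normed_vector) \<Rightarrow> bool" where
  "abs_continuous_on K y \<longleftrightarrow>
     (\<forall>\<epsilon>>0. \<exists>\<delta>>0. \<forall>I. finite I \<longrightarrow>
        (\<forall>(a, b)\<in>I. a \<in> K \<and> b \<in> K \<and> a \<le> b) \<longrightarrow>
        disjoint_family_on (\<lambda>(a, b). {a<..<b}) I \<longrightarrow>
        (\<Sum>(a, b)\<in>I. b - a) < \<delta> \<longrightarrow>
        (\<Sum>(a, b)\<in>I. norm (y b - y a)) < \<epsilon>)"

definition strong_solution ::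
  "'a::real_normed_vector set \<Rightarrow> ('a \<Rightarrow> 'a) \<Rightarrow> ('a \<Rightarrow> 'a) \<Rightarrow> (real \<Rightarrow> 'a) \<Rightarrow> real \<Rightarrow>
   (real \<Rightarrow> 'a) \<Rightarrow> bool" where
  "strong_solution D A F f T y \<longleftrightarrow>
     L1_fun T f \<and>
     continuous_on {0..T} y \<and>
     (\<forall>K. compact K \<longrightarrow> K \<subseteq> {0<..<T} \<longrightarrow> abs_continuous_on K y) \<and>
     (AE t in lebesgue_on {0<..<T}.
        y t \<in> D \<and> (y has_vector_derivative (A (y t) - F (y t) + f t)) (at t))"

definition weak_solution_on ::
  "'a::real_normed_vector set \<Rightarrow> ('a \<Rightarrow> 'a) \<Rightarrow> ('a \<Rightarrow> 'a) \<Rightarrow> 'a \<Rightarrow> real \<Rightarrow> (real \<Rightarrow> 'a) \<Rightarrow> bool" where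
  "weak_solution_on D A F y0 T y \<longleftrightarrow>
     continuous_on {0..T} y \<and>
     y 0 = y0 \<and>
     (\<exists>f Y. (\<lambda>n. L1_norm T (f n)) \<longlonglongrightarrow> 0 \<and>
        (\<forall>n::nat. strong_solution D A F (f n) T (Y n)) \<and>
        uniform_limit {0..T} Y y sequentially)"

definition weak_solution ::
  "'a::real_normed_vector set \<Rightarrow> ('a \<Rightarrow> 'a) \<Rightarrow> ('a \<Rightarrow> 'a) \<Rightarrow> 'a \<Rightarrow> (real \<Rightarrow> 'a) \<Rightarrow> bool" where
  "weak_solution D A F y0 y \<longleftrightarrow> (\<forall>T>0. weak_solution_on D A F y0 T y)"

end

theory Submission
  imports Defs
begin

text \<open>
  Since \<open>W\<close> lies in the kernel of \<open>B\<close>, on the domain of \<open>A\<close> the feedback coincides with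
  \<open>G0 = N + \<Upsilon> \<circ> P\<close>, where \<open>N x = \<langle>B x, x\<rangle>\<^sup>-\<^sup>\<mu> B x\<close> is the gradient of a convex function, hence
  monotone, and \<open>\<Upsilon> \<circ> P\<close> is Lipschitz. So \<open>A - F\<close> is dissipative up to a multiple of the identity,
  and the distance of two strong solutions is controlled by their initial distance and the
  \<open>L\<^sup>1\<close> norms of the forcing terms; uniqueness follows at once.

  For existence, \<open>N\<close> is a uniform limit of Lipschitz maps (truncate \<open>s\<^sup>-\<^sup>2\<^sup>\<mu>\<close> near \<open>s = 0\<close>; here
  \<open>2 \<mu> < 1\<close> enters), so \<open>G0\<close> is a uniform limit of Lipschitz maps \<open>G\<close>. For each such \<open>G\<close>, freeze
  the nonlinearity on intervals of length \<open>\<tau>\<close>: on \<open>[k \<tau>, (k + 1) \<tau>]\<close> let \<open>y' = A y - G (y (k \<tau>))\<close>. With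
  initial value in the domain, this has an explicit classical solution whose velocity stays
  bounded on bounded time intervals independently of \<open>\<tau>\<close>, so \<open>G0 (y t) - G (y (k \<tau>))\<close> is uniformly
  small and \<open>y\<close> is a strong solution with a small forcing term. By the distance estimate these
  approximations converge uniformly on bounded intervals.
\<close>

section \<open>Energy estimate for strong solutions\<close>

lemma AE_lebesgue_on_negligible:
  assumes "AE t in lebesgue_on X. Q t" "X \<in> sets lebesgue"
  obtains N where "negligible N" "\<And>t. t \<in> X \<Longrightarrow> t \<notin> N \<Longrightarrow> Q t"
proof -
  have "AE t in lebesgue. t \<in> X \<longrightarrow> Q t"
    using assms by (simp add: AE_restrict_space_iff)
  then obtain N where "N \<in> null_sets lebesgue" "{t. \<not> (t \<in> X \<longrightarrow> Q t)} \<subseteq> N"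
    by (auto simp: eventually_ae_filter)
  then show ?thesis using that by (auto simp: negligible_iff_null_sets)
qed

text \<open>Converts the \<open>ennreal\<close> norm into a gauge integral, the form that the
  increment estimate consumes. Measurability of the norm comes from the simple functions by a
  pointwise limit, and completeness of Lebesgue measure absorbs the exceptional set.\<close>

lemma L1_fun_norm_integrable:
  fixes f :: "real \<Rightarrow> 'a::real_normed_vector"
  assumes "L1_fun T f"
  shows "((\<lambda>t. norm (f t)) has_integral enn2real (L1_norm T f)) {0..T}"
proof -
  let ?X = "{0<..<T}"
  let ?M = "lebesgue_on ?X"
  obtain s :: "nat \<Rightarrow> real \<Rightarrow> 'a" where s: "\<And>i. simple_function ?M (s i)"
    and lim: "AE t in ?M. (\<lambda>i. s i t) \<longlonglongrightarrow> f t" and fin: "L1_norm T f < \<infinity>"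
    using assms by (auto simp: L1_fun_def)
  obtain N where N: "negligible N" "\<And>t. t \<in> ?X \<Longrightarrow> t \<notin> N \<Longrightarrow> (\<lambda>i. s i t) \<longlonglongrightarrow> f t"
    using AE_lebesgue_on_negligible[OF lim] by auto
  have N_sets: "N \<in> sets lebesgue"
    by (rule negligible_imp_sets[OF N(1)])
  \<comment> \<open>Zeroing on \<open>N\<close> and outside the interval turns almost everywhere
    convergence into convergence at every point.\<close>
  define g where "g t = (if t \<in> ?X then if t \<in> N then 0 else norm (f t) else 0)" for t
  define u where "u i t = (if t \<in> ?X then if t \<in> N then 0 else norm (s i t) else 0)" for i t
  have "u i \<in> borel_measurable lebesgue" for i
  proof -
    have "(\<lambda>t. norm (s i t)) \<in> borel_measurable ?M"
      by (rule borel_measurable_simple_function[OF simple_function_compose1[OF s]])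
    moreover have "Measurable.pred ?M (\<lambda>t. t \<in> N)"
      by (intro measurable_restrict_space1 pred_sets2[OF N_sets]) simp
    ultimately have "(\<lambda>t. if t \<in> N then 0 else norm (s i t)) \<in> borel_measurable ?M"
      by (intro measurable_If) (auto simp: pred_def)
    then show ?thesis
      unfolding u_def by (rule borel_measurable_if_I) simp
  qed
  moreover have "(\<lambda>i. u i t) \<longlonglongrightarrow> g t" for t
  proof (cases "t \<in> ?X \<and> t \<notin> N")
    case True
    then show ?thesis using tendsto_norm[OF N(2)[of t]] by (simp add: g_def u_def)
  qed (auto simp: g_def u_def)
  ultimately have "g \<in> borel_measurable lebesgue"
    by (rule borel_measurable_LIMSEQ_real[rotated])
  then have "(\<lambda>t. if t \<in> ?X then norm (f t) else 0) \<in> borel_measurable lebesgue"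
  proof (rule borel_measurable_AE)
    have "AE t in lebesgue. t \<notin> N"
      using N(1) by (simp add: AE_not_in negligible_iff_null_sets)
    then show "AE t in lebesgue. g t = (if t \<in> ?X then norm (f t) else 0)"
      by eventually_elim (simp add: g_def)
  qed
  then have meas: "(\<lambda>t. norm (f t)) \<in> borel_measurable ?M"
    by (rule borel_measurable_if_D)
  then have int: "integrable ?M (\<lambda>t. norm (f t))"
    using fin by (intro integrableI_bounded) (auto simp: L1_norm_def)
  have "integral\<^sup>L ?M (\<lambda>t. norm (f t)) = enn2real (L1_norm T f)"
    unfolding L1_norm_def by (rule integral_eq_nn_integral[OF meas]) auto
  then show ?thesis
    using has_integral_integral_lebesgue_on[OF int]
    by (simp add: has_integral_Icc_iff_Ioo)
qed

section \<open>Absolute continuity and bounds on increments\<close>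

lemma abs_continuous_onE:
  assumes "abs_continuous_on K y" "0 < e"
  obtains d where "0 < d" "\<And>I. finite I \<Longrightarrow> (\<forall>(a, b)\<in>I. a \<in> K \<and> b \<in> K \<and> a \<le> b) \<Longrightarrow>
        disjoint_family_on (\<lambda>(a, b). {a<..<b}) I \<Longrightarrow> (\<Sum>(a, b)\<in>I. b - a) < d \<Longrightarrow>
        (\<Sum>(a, b)\<in>I. norm (y b - y a)) < e"
proof -
  obtain d where "0 < d" and d: "\<forall>I. finite I \<longrightarrow> (\<forall>(a, b)\<in>I. a \<in> K \<and> b \<in> K \<and> a \<le> b) \<longrightarrow>
        disjoint_family_on (\<lambda>(a, b). {a<..<b}) I \<longrightarrow> (\<Sum>(a, b)\<in>I. b - a) < d \<longrightarrow>
        (\<Sum>(a, b)\<in>I. norm (y b - y a)) < e"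
    using assms(1)[unfolded abs_continuous_on_def, THEN spec, THEN mp, OF assms(2)]
    by (elim exE conjE)
  show ?thesis
    by (rule that[OF \<open>0 < d\<close> d[THEN spec, THEN mp, THEN mp, THEN mp, THEN mp]])
qed

text \<open>Carries absolute continuity from two solutions to a scalar function of them; the summand
  \<open>b - a\<close> covers an additional smooth dependence on time, such as an exponential
  weight.\<close>

lemma abs_continuous_on_dominated:
  fixes y1 y2 :: "real \<Rightarrow> 'a::real_normed_vector" and H :: "real \<Rightarrow> 'b::real_normed_vector"
  assumes "abs_continuous_on K y1" "abs_continuous_on K y2"
    and dom: "\<And>a b. a \<in> K \<Longrightarrow> b \<in> K \<Longrightarrow> a \<le> b \<Longrightarrow>
      norm (H b - H a) \<le> C * (norm (y1 b - y1 a) + norm (y2 b - y2 a) + (b - a))"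
    and "0 < C"
  shows "abs_continuous_on K H"
  unfolding abs_continuous_on_def
proof (intro allI impI)
  fix e :: real assume "0 < e"
  \<comment> \<open>Each of the three sums, the total length among them, is kept below
    \<open>e'\<close>; the factor \<open>C\<close> then restores \<open>e\<close>.\<close>
  define e' where "e' = e / (3 * C)"
  have "0 < e'" using \<open>0 < e\<close> \<open>0 < C\<close> by (simp add: e'_def)
  note E = abs_continuous_onE[OF _ \<open>0 < e'\<close>]
  obtain d1 where "0 < d1" and d1: "\<And>I. finite I \<Longrightarrow> (\<forall>(a, b)\<in>I. a \<in> K \<and> b \<in> K \<and> a \<le> b) \<Longrightarrow>
        disjoint_family_on (\<lambda>(a, b). {a<..<b}) I \<Longrightarrow> (\<Sum>(a, b)\<in>I. b - a) < d1 \<Longrightarrow>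
        (\<Sum>(a, b)\<in>I. norm (y1 b - y1 a)) < e'"
    using E[OF assms(1)] by blast
  obtain d2 where "0 < d2" and d2: "\<And>I. finite I \<Longrightarrow> (\<forall>(a, b)\<in>I. a \<in> K \<and> b \<in> K \<and> a \<le> b) \<Longrightarrow>
        disjoint_family_on (\<lambda>(a, b). {a<..<b}) I \<Longrightarrow> (\<Sum>(a, b)\<in>I. b - a) < d2 \<Longrightarrow>
        (\<Sum>(a, b)\<in>I. norm (y2 b - y2 a)) < e'"
    using E[OF assms(2)] by blast
  show "\<exists>d>0. \<forall>I. finite I \<longrightarrow> (\<forall>(a, b)\<in>I. a \<in> K \<and> b \<in> K \<and> a \<le> b) \<longrightarrow>
        disjoint_family_on (\<lambda>(a, b). {a<..<b}) I \<longrightarrow> (\<Sum>(a, b)\<in>I. b - a) < d \<longrightarrow>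
        (\<Sum>(a, b)\<in>I. norm (H b - H a)) < e"
  proof (intro exI[of _ "min (min d1 d2) e'"] conjI allI impI)
    show "0 < min (min d1 d2) e'" using \<open>0 < d1\<close> \<open>0 < d2\<close> \<open>0 < e'\<close> by simp
    fix I assume I: "finite I" "\<forall>(a, b)\<in>I. a \<in> K \<and> b \<in> K \<and> a \<le> b"
      "disjoint_family_on (\<lambda>(a, b). {a<..<b}) I" "(\<Sum>(a, b)\<in>I. b - a) < min (min d1 d2) e'"
    have "(\<Sum>(a, b)\<in>I. norm (H b - H a))
        \<le> (\<Sum>(a, b)\<in>I. C * (norm (y1 b - y1 a) + norm (y2 b - y2 a) + (b - a)))"
      by (rule sum_mono) (use I(2) dom in auto)
    also have "\<dots> = C * ((\<Sum>(a, b)\<in>I. norm (y1 b - y1 a)) + (\<Sum>(a, b)\<in>I. norm (y2 b - y2 a))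
        + (\<Sum>(a, b)\<in>I. b - a))"
      by (simp add: case_prod_unfold sum_distrib_left sum.distrib distrib_left)
    also have "\<dots> < C * (e' + e' + e')"
      using d1[OF I(1-3)] d2[OF I(1-3)] I(4) \<open>0 < C\<close> by (intro mult_strict_left_mono) auto
    also have "\<dots> = e" using \<open>0 < C\<close> by (simp add: e'_def)
    finally show "(\<Sum>(a, b)\<in>I. norm (H b - H a)) < e" .
  qed
qed

lemma lipschitz_imp_abs_continuous_on:
  fixes y :: "real \<Rightarrow> 'a::real_normed_vector"
  assumes "\<And>a b. a \<in> K \<Longrightarrow> b \<in> K \<Longrightarrow> a \<le> b \<Longrightarrow> norm (y b - y a) \<le> C * (b - a)"
  shows "abs_continuous_on K y"
proof (rule abs_continuous_on_dominated)
  have const: "abs_continuous_on K (\<lambda>_. 0 :: real)"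
    unfolding abs_continuous_on_def
  proof (intro allI impI)
    fix e :: real assume "0 < e"
    moreover have "(\<Sum>(a, b)\<in>I. norm (0 - 0 :: real)) = 0" for I :: "(real \<times> real) set"
      by (rule sum.neutral) auto
    ultimately show "\<exists>d>0. \<forall>I. finite I \<longrightarrow> (\<forall>(a, b)\<in>I. a \<in> K \<and> b \<in> K \<and> a \<le> b) \<longrightarrow>
        disjoint_family_on (\<lambda>(a, b). {a<..<b}) I \<longrightarrow> (\<Sum>(a, b)\<in>I. b - a) < d \<longrightarrow>
        (\<Sum>(a, b)\<in>I. norm (0 - 0 :: real)) < e"
      by (intro exI[of _ 1]) (simp only: zero_less_one simp_thms)
  qed
  show "abs_continuous_on K (\<lambda>_. 0 :: real)" "abs_continuous_on K (\<lambda>_. 0 :: real)"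
    by (rule const)+
  fix a b assume ab: "a \<in> K" "b \<in> K" "a \<le> b"
  have "norm (y b - y a) \<le> C * (b - a)" using assms ab by blast
  \<comment> \<open>\<open>C\<close> may fail to be positive, while the domination lemma asks for a
    positive constant.\<close>
  also have "\<dots> \<le> max 1 C * (b - a)" using ab by (intro mult_right_mono) auto
  finally show "norm (y b - y a) \<le> max 1 C * (norm (0 - 0 :: real) + norm (0 - 0 :: real) + (b - a))"
    by simp
qed simp

text \<open>
  The gauge follows the derivative off the null set \<open>N\<close>; on \<open>N\<close> it confines the intervals to an
  open set of small measure, where absolute continuity makes the increments of \<open>H\<close> negligible.
\<close>

lemma abs_continuous_on_increment_le:
  fixes H h g :: "real \<Rightarrow> real"
  assumes ab: "a \<le> b" and ac: "abs_continuous_on {a..b} H" and N: "negligible N"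
    and der: "\<And>t. t \<in> {a..b} \<Longrightarrow> t \<notin> N \<Longrightarrow> (H has_real_derivative h t) (at t)"
    and le: "\<And>t. t \<in> {a..b} \<Longrightarrow> t \<notin> N \<Longrightarrow> h t \<le> g t"
    and int: "(g has_integral I) {a..b}"
  shows "H b - H a \<le> I"
proof (rule field_le_epsilon)
  fix e0 :: real assume "0 < e0"
  \<comment> \<open>Error budget: one \<open>e\<close> for the Riemann sum of \<open>g0\<close>, one
    for the tags in \<open>N\<close>, and \<open>e * (b - a)\<close> for the differentiability
    errors.\<close>
  define e where "e = e0 / (2 + (b - a))"
  have "0 < e" using \<open>0 < e0\<close> ab by (simp add: e_def)
  \<comment> \<open>On \<open>N\<close> nothing relates \<open>g\<close> to \<open>H\<close>, so its
    values there are replaced by zero; the integral is unchanged.\<close>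
  define g0 where "g0 t = (if t \<in> N then 0 else g t)" for t
  have "(g0 has_integral I) {a..b}"
    by (rule has_integral_spike[OF N _ int]) (simp add: g0_def)
  then obtain \<gamma> where \<gamma>: "gauge \<gamma>"
    and \<gamma>_fine: "\<And>p. p tagged_division_of {a..b} \<Longrightarrow> \<gamma> fine p \<Longrightarrow>
      norm ((\<Sum>(x, K)\<in>p. measure lborel K *\<^sub>R g0 x) - I) < e"
    using \<open>0 < e\<close> by (metis has_integral_real)
  obtain \<delta> where "0 < \<delta>" and \<delta>: "\<And>I. finite I \<Longrightarrow> (\<forall>(u, v)\<in>I. u \<in> {a..b} \<and> v \<in> {a..b} \<and> u \<le> v) \<Longrightarrow>
        disjoint_family_on (\<lambda>(u, v). {u<..<v}) I \<Longrightarrow> (\<Sum>(u, v)\<in>I. v - u) < \<delta> \<Longrightarrow>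
        (\<Sum>(u, v)\<in>I. norm (H v - H u)) < e"
    using abs_continuous_onE[OF ac \<open>0 < e\<close>] by blast
  obtain U where U: "open U" "N \<subseteq> U" "emeasure lebesgue U < ennreal \<delta>"
  proof -
    obtain U where U: "open U" "N \<subseteq> U" "emeasure lebesgue (U - N) < ennreal \<delta>"
      using sets_lebesgue_outer_open[OF negligible_imp_sets[OF N] \<open>0 < \<delta>\<close>] by metis
    moreover have "emeasure lebesgue (U - N) = emeasure lebesgue U"
      using N U(1) by (intro emeasure_Diff_null_set) (auto simp: negligible_iff_null_sets)
    ultimately show ?thesis using that by simp
  qed
  have "\<exists>d>0. \<forall>y. \<bar>y - t\<bar> < d \<longrightarrow> \<bar>H y - H t - (y - t) * h t\<bar> \<le> e * \<bar>y - t\<bar>"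
    if t: "t \<in> {a..b}" "t \<notin> N" for t
  proof -
    have "(H has_derivative (\<lambda>y. y * h t)) (at t)"
      using der[OF t] by (simp add: has_field_derivative_def mult_commute_abs)
    then show ?thesis using \<open>0 < e\<close> unfolding has_derivative_at_alt by auto
  qed
  then obtain d where d: "\<And>t. t \<in> {a..b} \<Longrightarrow> t \<notin> N \<Longrightarrow> 0 < d t"
    and d_der: "\<And>t y. t \<in> {a..b} \<Longrightarrow> t \<notin> N \<Longrightarrow> \<bar>y - t\<bar> < d t \<Longrightarrow>
      \<bar>H y - H t - (y - t) * h t\<bar> \<le> e * \<bar>y - t\<bar>"
    by metis
  define \<gamma>' where "\<gamma>' t = \<gamma> t \<inter> (if t \<in> N then U else if t \<in> {a..b} then ball t (d t) else UNIV)" for t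
  have "gauge \<gamma>'"
    using \<gamma> U d by (auto simp: gauge_def \<gamma>'_def)
  then obtain p where p: "p tagged_division_of {a..b}" "\<gamma>' fine p"
    using fine_division_exists_real by blast
  then have "\<gamma> fine p" by (auto simp: fine_def \<gamma>'_def)
  note p_D = tagged_division_ofD[OF p(1)]
  have fin: "finite p" using p_D(1) .
  have interval: "K = {Inf K..Sup K} \<and> a \<le> Inf K \<and> Inf K \<le> x \<and> x \<le> Sup K \<and> Sup K \<le> b \<and>
      measure lborel K = Sup K - Inf K" if xK: "(x, K) \<in> p" for x K
  proof -
    obtain u v where "K = {u..v}" using p_D(4)[OF xK] by auto
    then show ?thesis using p_D(2,3)[OF xK] by (auto simp: subset_iff)
  qed
  \<comment> \<open>Degenerate intervals have zero increment and are left out. The remaining ones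
    have nonempty disjoint interiors, so the map \<open>ends\<close> is injective on
    \<open>q\<close>.\<close>
  define q where "q = {(x, K) \<in> p. x \<in> N \<and> Inf K < Sup K}"
  define ends where "ends = (\<lambda>(x :: real, K :: real set). (Inf K, Sup K))"
  have q_sub: "q \<subseteq> p" by (auto simp: q_def)
  have disj: "{Inf K<..<Sup K} \<inter> {Inf K'<..<Sup K'} = {}"
    if "(x, K) \<in> q" "(x', K') \<in> q" "(x, K) \<noteq> (x', K')" for x K x' K'
  proof -
    have "interior K \<inter> interior K' = {}" using p_D(5) that q_sub by blast
    moreover have "interior K = {Inf K<..<Sup K}" "interior K' = {Inf K'<..<Sup K'}"
      using interval that q_sub by (metis interior_atLeastAtMost_real subsetD)+
    ultimately show ?thesis by simp
  qed
  have inj: "inj_on ends q"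
  proof (rule inj_onI, rule ccontr)
    fix z z' assume z: "z \<in> q" "z' \<in> q" "ends z = ends z'" "z \<noteq> z'"
    then show False
      using disj[of "fst z" "snd z" "fst z'" "snd z'"]
      by (auto simp: ends_def q_def split: prod.splits)
  qed
  have family: "disjoint_family_on (\<lambda>(u, v). {u<..<v}) (ends ` q)"
    unfolding disjoint_family_on_def
  proof (intro ballI impI)
    fix m n assume "m \<in> ends ` q" "n \<in> ends ` q" "m \<noteq> n"
    then obtain x K x' K' where "(x, K) \<in> q" "m = (Inf K, Sup K)" "(x', K') \<in> q" "n = (Inf K', Sup K')"
      by (auto simp: ends_def)
    with disj[of x K x' K'] \<open>m \<noteq> n\<close>
    show "(case m of (u, v) \<Rightarrow> {u<..<v}) \<inter> (case n of (u, v) \<Rightarrow> {u<..<v}) = {}" by auto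
  qed
  have fin_ends: "finite (ends ` q)" using fin q_sub by (auto intro: finite_subset)
  have "(\<Sum>(u, v)\<in>ends ` q. v - u) = (\<Sum>m\<in>ends ` q. measure lebesgue (case m of (u, v) \<Rightarrow> {u<..<v}))"
    by (rule sum.cong) (auto simp: q_def ends_def)
  also have "\<dots> = measure lebesgue (\<Union>m\<in>ends ` q. case m of (u, v) \<Rightarrow> {u<..<v})"
    using fin_ends family by (intro measure_finite_Union[symmetric]) (auto simp: q_def ends_def)
  also have "\<dots> < \<delta>"
  proof -
    let ?V = "\<Union>m\<in>ends ` q. case m of (u, v) \<Rightarrow> {u<..<v}"
    have "?V \<subseteq> U"
    proof
      fix t assume "t \<in> ?V"
      then obtain x K where xK: "(x, K) \<in> q" "Inf K < t" "t < Sup K" by (auto simp: ends_def)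
      then have "K = {Inf K..Sup K}" using interval[of x K] q_sub by blast
      then have "t \<in> K" using xK(2,3) by (metis atLeastAtMost_iff less_imp_le)
      moreover have "K \<subseteq> \<gamma>' x" using p(2) q_sub xK by (auto simp: fine_def)
      ultimately show "t \<in> U" using xK by (auto simp: \<gamma>'_def q_def)
    qed
    then have "emeasure lebesgue ?V \<le> emeasure lebesgue U"
      using U(1) by (intro emeasure_mono) auto
    then have "emeasure lebesgue ?V < ennreal \<delta>" using U(3) by simp
    then have "ennreal (measure lebesgue ?V) < ennreal \<delta>"
      by (subst emeasure_eq_ennreal_measure[symmetric]) (auto simp: less_top[symmetric] dest: order.strict_trans)
    then show ?thesis by (simp add: ennreal_less_iff)
  qed
  finally have "(\<Sum>(u, v)\<in>ends ` q. norm (H v - H u)) < e"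
    using interval q_sub by (intro \<delta> fin_ends family) (force simp: ends_def)+
  then have small: "(\<Sum>(x, K)\<in>q. \<bar>H (Sup K) - H (Inf K)\<bar>) < e"
    by (subst (asm) sum.reindex[OF inj]) (simp add: ends_def case_prod_unfold)
  have local_le: "H (Sup K) - H (Inf K) \<le> measure lborel K *\<^sub>R g0 x + e * measure lborel K
      + (if (x, K) \<in> q then \<bar>H (Sup K) - H (Inf K)\<bar> else 0)" if xK: "(x, K) \<in> p" for x K
  proof (cases "x \<in> N")
    case True
    have "0 \<le> e * (Sup K - Inf K)" using interval[OF xK] \<open>0 < e\<close> by simp
    moreover have "Inf K \<le> Sup K" using interval[OF xK] by linarith
    ultimately show ?thesis using interval[OF xK] True xK
      by (cases "Inf K = Sup K") (auto simp: q_def g0_def)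
  next
    case False
    have x: "x \<in> {a..b}" using interval[OF xK] by auto
    have "K \<subseteq> \<gamma>' x" using fineD[OF p(2) xK] .
    then have "K \<subseteq> ball x (d x)" using x False by (simp add: \<gamma>'_def)
    moreover have "Sup K \<in> K" "Inf K \<in> K" using interval[OF xK] by (metis atLeastAtMost_iff order_refl order_trans)+
    ultimately have "\<bar>Sup K - x\<bar> < d x" "\<bar>Inf K - x\<bar> < d x" by (auto simp: dist_real_def)
    \<comment> \<open>The tag splits the interval, and each half is compared with the linear
      approximation at the tag, as in the straddle lemma.\<close>
    then have "H (Sup K) - H x \<le> (Sup K - x) * h x + e * (Sup K - x)"
      "H x - H (Inf K) \<le> (x - Inf K) * h x + e * (x - Inf K)"
      using d_der[OF x False, of "Sup K"] d_der[OF x False, of "Inf K"] interval[OF xK]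
      by (auto simp: abs_le_iff algebra_simps)
    then have "H (Sup K) - H (Inf K) \<le> (Sup K - Inf K) * h x + e * (Sup K - Inf K)"
      by (simp add: algebra_simps)
    then have "H (Sup K) - H (Inf K) \<le> measure lborel K * h x + e * measure lborel K"
      using interval[OF xK] by simp
    moreover have "measure lborel K * h x \<le> measure lborel K * g0 x"
      using le[OF x False] False interval[OF xK] by (intro mult_left_mono) (auto simp: g0_def)
    moreover have "0 \<le> (if (x, K) \<in> q then \<bar>H (Sup K) - H (Inf K)\<bar> else 0)" by simp
    ultimately show ?thesis unfolding real_scaleR_def by linarith
  qed
  have "H b - H a = (\<Sum>(x, K)\<in>p. H (Sup K) - H (Inf K))"
    by (rule additive_tagged_division_1[OF ab p(1), symmetric])
  also have "\<dots> \<le> (\<Sum>(x, K)\<in>p. measure lborel K *\<^sub>R g0 x + e * measure lborel K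
      + (if (x, K) \<in> q then \<bar>H (Sup K) - H (Inf K)\<bar> else 0))"
    using local_le by (intro sum_mono) auto
  also have "\<dots> = (\<Sum>(x, K)\<in>p. measure lborel K *\<^sub>R g0 x) + e * (\<Sum>(x, K)\<in>p. measure lborel K)
      + (\<Sum>z\<in>p. if z \<in> q then \<bar>H (Sup (snd z)) - H (Inf (snd z))\<bar> else 0)"
    by (simp add: case_prod_unfold sum.distrib sum_distrib_left)
  also have "(\<Sum>(x, K)\<in>p. measure lborel K) = b - a"
    using additive_content_tagged_division[of p a b] p(1) ab by simp
  also have "(\<Sum>z\<in>p. if z \<in> q then \<bar>H (Sup (snd z)) - H (Inf (snd z))\<bar> else 0)
      = (\<Sum>(x, K)\<in>q. \<bar>H (Sup K) - H (Inf K)\<bar>)"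
    using sum.inter_restrict[OF fin, of "\<lambda>z. \<bar>H (Sup (snd z)) - H (Inf (snd z))\<bar>" q] q_sub
    by (simp add: Int_absorb1 case_prod_unfold)
  also have "(\<Sum>(x, K)\<in>p. measure lborel K *\<^sub>R g0 x) + e * (b - a) + \<dots> \<le> (I + e) + e * (b - a) + e"
    using \<gamma>_fine[OF p(1) \<open>\<gamma> fine p\<close>] small by (intro add_mono) (auto simp: abs_less_iff)
  also have "\<dots> = I + e0"
  proof -
    have "e * (2 + (b - a)) = e0" using ab by (simp add: e_def)
    then show ?thesis by (simp add: algebra_simps)
  qed
  finally show "H b - H a \<le> I + e0" .
qed

text \<open>Gronwall argument with the integrating factor \<open>exp (- 2 * K * t)\<close>:
  dissipativity bounds the derivative of the weighted squared distance by the forcing alone, and the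
  a priori bound \<open>M\<close> makes that contribution linear in the norms of \<open>f1\<close>
  and \<open>f2\<close>.\<close>

lemma strong_solutions_energy:
  fixes A F :: "'a::real_inner \<Rightarrow> 'a"
  assumes diss: "\<And>x z. x \<in> D \<Longrightarrow> z \<in> D \<Longrightarrow>
      ((A x - F x) - (A z - F z)) \<bullet> (x - z) \<le> K * (norm (x - z))\<^sup>2"
    and K: "0 \<le> K" and T: "0 < T"
    and sol1: "strong_solution D A F f1 T y1" and sol2: "strong_solution D A F f2 T y2"
    and M: "\<And>t. t \<in> {0..T} \<Longrightarrow> norm (y1 t - y2 t) \<le> M"
    and t: "t \<in> {0..T}"
  shows "(norm (y1 t - y2 t))\<^sup>2 \<le> exp (2 * K * T) *
      ((norm (y1 0 - y2 0))\<^sup>2 + 2 * M * (enn2real (L1_norm T f1) + enn2real (L1_norm T f2)))"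
proof -
  define \<gamma> where "\<gamma> = enn2real (L1_norm T f1) + enn2real (L1_norm T f2)"
  define w where "w t = y1 t - y2 t" for t
  define H where "H t = exp (- 2 * K * t) * (w t \<bullet> w t)" for t
  have M0: "0 \<le> M" using order_trans[OF norm_ge_zero M[of 0]] T by simp
  have wM: "norm (w t) \<le> M" if "t \<in> {0..T}" for t using M[OF that] by (simp add: w_def)
  obtain N1 where N1: "negligible N1" "\<And>t. t \<in> {0<..<T} \<Longrightarrow> t \<notin> N1 \<Longrightarrow> y1 t \<in> D \<and>
      (y1 has_vector_derivative (A (y1 t) - F (y1 t) + f1 t)) (at t)"
    using sol1 unfolding strong_solution_def by (elim conjE) (erule AE_lebesgue_on_negligible, auto)
  obtain N2 where N2: "negligible N2" "\<And>t. t \<in> {0<..<T} \<Longrightarrow> t \<notin> N2 \<Longrightarrow> y2 t \<in> D \<and>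
      (y2 has_vector_derivative (A (y2 t) - F (y2 t) + f2 t)) (at t)"
    using sol2 unfolding strong_solution_def by (elim conjE) (erule AE_lebesgue_on_negligible, auto)
  define w' where "w' t = (A (y1 t) - F (y1 t) + f1 t) - (A (y2 t) - F (y2 t) + f2 t)" for t
  define h where "h t = exp (- 2 * K * t) * (2 * (w' t \<bullet> w t)) + (- 2 * K * exp (- 2 * K * t)) * (w t \<bullet> w t)" for t
  define g where "g t = 2 * M * (norm (f1 t) + norm (f2 t))" for t
  have g_int: "(g has_integral 2 * M * \<gamma>) {0..T}"
    unfolding g_def \<gamma>_def using sol1 sol2
    by (intro has_integral_mult_right has_integral_add L1_fun_norm_integrable)
       (auto simp: strong_solution_def)
  have der: "(H has_real_derivative h t) (at t)" and le: "h t \<le> g t"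
    if t: "t \<in> {0<..<T}" "t \<notin> N1 \<union> N2" for t
  proof -
    have D: "y1 t \<in> D" "y2 t \<in> D" using N1 N2 t by auto
    have "(w has_vector_derivative w' t) (at t)"
      unfolding w_def w'_def using N1(2)[of t] N2(2)[of t] t
      by (intro has_vector_derivative_diff) auto
    then have "(w has_derivative (\<lambda>s. s *\<^sub>R w' t)) (at t)"
      by (simp add: has_vector_derivative_def)
    from has_derivative_inner[OF this this]
    have "((\<lambda>t. w t \<bullet> w t) has_real_derivative 2 * (w' t \<bullet> w t)) (at t)"
      unfolding has_field_derivative_def
      by (rule has_derivative_eq_rhs) (auto simp: inner_commute algebra_simps)
    moreover have "((\<lambda>t. exp (- 2 * K * t)) has_real_derivative - 2 * K * exp (- 2 * K * t)) (at t)"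
      by (auto intro!: derivative_eq_intros)
    ultimately show "(H has_real_derivative h t) (at t)"
      unfolding H_def h_def by (auto intro!: derivative_eq_intros)
    have "w' t \<bullet> w t = ((A (y1 t) - F (y1 t)) - (A (y2 t) - F (y2 t))) \<bullet> (y1 t - y2 t)
        + (f1 t - f2 t) \<bullet> w t"
      by (simp add: w'_def w_def inner_diff_left inner_add_left inner_diff_right)
    also have "\<dots> \<le> K * (w t \<bullet> w t) + norm (f1 t - f2 t) * norm (w t)"
      using diss[OF D] by (intro add_mono norm_cauchy_schwarz) (simp add: w_def power2_norm_eq_inner)
    also have "norm (f1 t - f2 t) * norm (w t) \<le> (norm (f1 t) + norm (f2 t)) * M"
      using wM[of t] t by (intro mult_mono norm_triangle_ineq4) auto
    finally have "w' t \<bullet> w t - K * (w t \<bullet> w t) \<le> g t / 2"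
      by (simp add: g_def algebra_simps)
    then have "2 * exp (- 2 * K * t) * (w' t \<bullet> w t - K * (w t \<bullet> w t)) \<le> 2 * exp (- 2 * K * t) * (g t / 2)"
      by (intro mult_left_mono) auto
    also have "\<dots> \<le> 1 * g t"
      using K t M0 by (simp add: g_def mult_left_le_one_le)
    finally show "h t \<le> g t" by (simp add: h_def algebra_simps)
  qed
  \<comment> \<open>Absolute continuity is available only on compact subsets of the open interval,
    so increments are first bounded away from \<open>0\<close> and \<open>T\<close>.\<close>
  have incr: "H b - H a \<le> 2 * M * \<gamma>" if ab: "0 < a" "a \<le> b" "b < T" for a b
  proof -
    have sub: "{a..b} \<subseteq> {0<..<T}" "{a..b} \<subseteq> {0..T}" using ab by auto
    have "abs_continuous_on {a..b} H"
    proof (rule abs_continuous_on_dominated)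
      show "abs_continuous_on {a..b} y1" "abs_continuous_on {a..b} y2"
        using sol1 sol2 sub by (auto simp: strong_solution_def)
      \<comment> \<open>\<open>2 * M\<close> comes from the difference of squares,
        \<open>2 * K * M\<^sup>2\<close> from the variation of the weight, and \<open>1\<close>
        ensures strict positivity.\<close>
      show "0 < 2 * M + 2 * K * M\<^sup>2 + 1" using M0 K by (simp add: add_nonneg_pos)
      fix s r assume sr: "s \<in> {a..b}" "r \<in> {a..b}" "s \<le> r"
      have s0: "s \<in> {0..T}" "r \<in> {0..T}" using sr sub by auto
      have "w r \<bullet> w r - w s \<bullet> w s = (w r - w s) \<bullet> (w r + w s)"
        by (simp add: inner_diff_left inner_diff_right inner_add_right inner_add_left inner_commute)
      then have "\<bar>w r \<bullet> w r - w s \<bullet> w s\<bar> \<le> norm (w r - w s) * norm (w r + w s)"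
        by (simp add: Cauchy_Schwarz_ineq2)
      also have "\<dots> \<le> norm (w r - w s) * (2 * M)"
        using wM[OF s0(1)] wM[OF s0(2)] norm_triangle_ineq[of "w r" "w s"]
        by (intro mult_left_mono) auto
      also have "\<dots> \<le> (norm (y1 r - y1 s) + norm (y2 r - y2 s)) * (2 * M)"
        using norm_triangle_ineq4[of "y1 r - y1 s" "y2 r - y2 s"] M0
        by (intro mult_right_mono) (simp_all add: w_def algebra_simps)
      finally have 1: "\<bar>w r \<bullet> w r - w s \<bullet> w s\<bar> \<le> (norm (y1 r - y1 s) + norm (y2 r - y2 s)) * (2 * M)" .
      have 2: "\<bar>exp (- 2 * K * r) - exp (- 2 * K * s)\<bar> \<le> 2 * K * (r - s)"
      proof -
        have "exp (- 2 * K * r) = exp (- 2 * K * s) * exp (- 2 * K * (r - s))"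
          by (simp add: exp_add[symmetric] algebra_simps)
        moreover have "exp (- 2 * K * (r - s)) \<le> 1" using K sr by simp
        ultimately have "\<bar>exp (- 2 * K * r) - exp (- 2 * K * s)\<bar>
            = exp (- 2 * K * s) * (1 - exp (- 2 * K * (r - s)))"
          by (simp add: abs_if algebra_simps mult_left_le not_less)
        also have "\<dots> \<le> 1 * (2 * K * (r - s))"
          using K s0(1) exp_ge_add_one_self[of "- 2 * K * (r - s)"] sr by (intro mult_mono) auto
        finally show ?thesis by simp
      qed
      have "H r - H s = exp (- 2 * K * r) * (w r \<bullet> w r - w s \<bullet> w s)
          + (exp (- 2 * K * r) - exp (- 2 * K * s)) * (w s \<bullet> w s)"
        by (simp add: H_def algebra_simps)
      then have "norm (H r - H s) \<le> exp (- 2 * K * r) * \<bar>w r \<bullet> w r - w s \<bullet> w s\<bar>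
          + \<bar>exp (- 2 * K * r) - exp (- 2 * K * s)\<bar> * (w s \<bullet> w s)"
        using abs_triangle_ineq[of "exp (- 2 * K * r) * (w r \<bullet> w r - w s \<bullet> w s)"
            "(exp (- 2 * K * r) - exp (- 2 * K * s)) * (w s \<bullet> w s)"] by (simp add: abs_mult)
      also have "\<dots> \<le> 1 * ((norm (y1 r - y1 s) + norm (y2 r - y2 s)) * (2 * M)) + 2 * K * (r - s) * M\<^sup>2"
        using 1 2 K s0 sr wM[OF s0(1)]
        by (intro add_mono mult_mono) (auto simp: dot_square_norm power_mono)
      also have "\<dots> = 2 * M * (norm (y1 r - y1 s) + norm (y2 r - y2 s)) + 2 * K * M\<^sup>2 * (r - s)"
        by simp
      also have "\<dots> \<le> (2 * M + 2 * K * M\<^sup>2 + 1) * (norm (y1 r - y1 s) + norm (y2 r - y2 s) + (r - s))"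
      proof -
        have "0 \<le> 2 * K * M\<^sup>2" using K by simp
        moreover have "0 \<le> norm (y1 r - y1 s) + norm (y2 r - y2 s)" "0 \<le> r - s" using sr by auto
        ultimately show ?thesis
          using M0 by (simp add: distrib_left distrib_right add_nonneg_nonneg)
      qed
      finally show "norm (H r - H s) \<le> (2 * M + 2 * K * M\<^sup>2 + 1) *
          (norm (y1 r - y1 s) + norm (y2 r - y2 s) + (r - s))" .
    qed
    moreover have "negligible (N1 \<union> N2)" using N1 N2 by (simp add: negligible_Un)
    moreover have "(g has_integral integral {a..b} g) {a..b}"
      using g_int sub by (metis has_integral_integrable_integral integrable_integral integrable_on_subinterval)
    ultimately have "H b - H a \<le> integral {a..b} g"
      using ab der le sub by (intro abs_continuous_on_increment_le[where H = H and a = a and b = b and h = h and g = g and N = "N1 \<union> N2"]) (auto simp: subset_iff)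
    also have "\<dots> \<le> integral {0..T} g"
      using g_int sub M0
      by (intro integral_subset_le) (auto simp: g_def intro: integrable_on_subinterval)
    also have "\<dots> = 2 * M * \<gamma>" using g_int by (rule integral_unique)
    finally show ?thesis .
  qed
  have cont: "continuous_on {0..T} H"
    unfolding H_def w_def using sol1 sol2 by (intro continuous_intros) (auto simp: strong_solution_def)
  \<comment> \<open>Continuity of \<open>H\<close> on the closed interval admits the left endpoint,
    and afterwards the right one.\<close>
  have "H b \<le> H 0 + 2 * M * \<gamma>" if b: "b \<in> {0<..<T}" for b
  proof -
    have cl: "closure {0<..<b} = {0..b}" using b by (intro closure_greaterThanLessThan) simp
    have "- H 0 \<le> 2 * M * \<gamma> - H b"
    proof (rule continuous_le_on_closure[where S = "{0<..<b}" and f = "\<lambda>a. - H a" and x = 0])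
      show "continuous_on (closure {0<..<b}) (\<lambda>a. - H a)"
        unfolding cl using b by (intro continuous_intros continuous_on_subset[OF cont]) auto
      show "0 \<in> closure {0<..<b}" unfolding cl using b by simp
      show "- H a \<le> 2 * M * \<gamma> - H b" if "a \<in> {0<..<b}" for a
        using incr[of a b] that b by auto
    qed
    then show ?thesis by simp
  qed
  then have "H t \<le> H 0 + 2 * M * \<gamma>"
    using continuous_le_on_closure[of "{0<..<T}" H t] cont t T by (auto simp: closure_greaterThanLessThan)
  then have *: "(norm (w t))\<^sup>2 * exp (- 2 * K * t) \<le> (norm (w 0))\<^sup>2 + 2 * M * \<gamma>"
    by (simp add: H_def power2_norm_eq_inner mult.commute)
  have "0 \<le> 2 * M * \<gamma>" using M0 by (simp add: \<gamma>_def)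
  have "(norm (w t))\<^sup>2 = exp (2 * K * t) * ((norm (w t))\<^sup>2 * exp (- 2 * K * t))"
    by (simp add: exp_minus field_simps)
  also have "\<dots> \<le> exp (2 * K * T) * ((norm (w 0))\<^sup>2 + 2 * M * \<gamma>)"
    using * t K \<open>0 \<le> 2 * M * \<gamma>\<close> by (intro mult_mono) (auto intro: mult_left_mono)
  finally show ?thesis by (simp add: w_def \<gamma>_def)
qed

text \<open>Choosing \<open>M\<close> as the maximal distance makes the energy estimate quadratic in
  \<open>M\<close>. Since the initial distance \<open>a\<close> is at most \<open>M\<close>, one
  factor \<open>M\<close> cancels and a linear estimate remains.\<close>

lemma strong_solutions_dist:
  fixes A F :: "'a::real_inner \<Rightarrow> 'a"
  assumes diss: "\<And>x z. x \<in> D \<Longrightarrow> z \<in> D \<Longrightarrow>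
      ((A x - F x) - (A z - F z)) \<bullet> (x - z) \<le> K * (norm (x - z))\<^sup>2"
    and K: "0 \<le> K" and T: "0 < T"
    and sol1: "strong_solution D A F f1 T y1" and sol2: "strong_solution D A F f2 T y2"
    and t: "t \<in> {0..T}"
  shows "norm (y1 t - y2 t) \<le> 2 * exp (2 * K * T) *
    (norm (y1 0 - y2 0) + enn2real (L1_norm T f1) + enn2real (L1_norm T f2))"
proof -
  define C where "C = exp (2 * K * T)"
  define a where "a = norm (y1 0 - y2 0)"
  define \<gamma> where "\<gamma> = enn2real (L1_norm T f1) + enn2real (L1_norm T f2)"
  have nonneg: "0 \<le> a" "0 \<le> \<gamma>" by (auto simp: a_def \<gamma>_def)
  have "continuous_on {0..T} (\<lambda>t. norm (y1 t - y2 t))"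
    using sol1 sol2 by (intro continuous_intros) (auto simp: strong_solution_def)
  then obtain r where r: "r \<in> {0..T}" "\<And>t. t \<in> {0..T} \<Longrightarrow> norm (y1 t - y2 t) \<le> norm (y1 r - y2 r)"
    using continuous_attains_sup[of "{0..T}" "\<lambda>t. norm (y1 t - y2 t)"] T by auto
  define M where "M = norm (y1 r - y2 r)"
  have "M\<^sup>2 \<le> C * (a\<^sup>2 + 2 * M * \<gamma>)"
    unfolding M_def C_def a_def \<gamma>_def
    by (rule strong_solutions_energy[OF diss K T sol1 sol2 r(2,1)])
  also have "\<dots> \<le> C * (2 * M * (a + \<gamma>))"
  proof -
    have "a \<le> M" using r(2)[of 0] T by (simp add: a_def M_def)
    then have "a\<^sup>2 \<le> 2 * M * a"
      using nonneg mult_right_mono[of a M a] mult_nonneg_nonneg[of M a]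
      unfolding power2_eq_square by linarith
    then show ?thesis by (intro mult_left_mono) (auto simp: C_def algebra_simps)
  qed
  finally have "M * M \<le> M * (2 * C * (a + \<gamma>))" by (simp add: power2_eq_square mult_ac)
  then have "M \<le> 2 * C * (a + \<gamma>)"
    using nonneg by (cases "M = 0") (auto simp: M_def C_def mult_le_cancel_left)
  then show ?thesis using r(2)[OF t] by (simp add: M_def C_def a_def \<gamma>_def add.assoc)
qed

section \<open>Quasi-contractive semigroups\<close>

text \<open>The Banach-Steinhaus theorem by Baire category: one of the closed sets
  \<open>C k\<close> contains a ball, and differences of points of that ball bound the operators
  near the origin.\<close>

lemma uniform_boundedness:
  fixes f :: "nat \<Rightarrow> 'a::banach \<Rightarrow> 'b::real_normed_vector"
  assumes lin: "\<And>n. bounded_linear (f n)" and bdd: "\<And>x. \<exists>K. \<forall>n. norm (f n x) \<le> K"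
  obtains K where "0 \<le> K" "\<And>n x. norm (f n x) \<le> K * norm x"
proof -
  define C where "C k = {x. \<forall>n. norm (f n x) \<le> real k}" for k :: nat
  have closed: "closed (C k)" for k
  proof -
    have "C k = (\<Inter>n. {x. norm (f n x) \<le> real k})"
      by (auto simp: C_def)
    moreover have "closed {x. norm (f n x) \<le> real k}" for n
      by (intro closed_Collect_le continuous_intros linear_continuous_on lin)
    ultimately show ?thesis by auto
  qed
  have cover: "(\<Union>k. C k) = UNIV"
  proof -
    have "\<exists>k. x \<in> C k" for x
    proof -
      obtain K where "\<forall>n. norm (f n x) \<le> K" using bdd by blast
      moreover obtain k where "K \<le> real k" using real_arch_simple by blast
      ultimately show ?thesis unfolding C_def by (auto intro: order_trans)
    qed
    then show ?thesis by auto
  qed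
  have "\<exists>k. interior (C k) \<noteq> {}"
  proof (rule ccontr)
    assume "\<nexists>k. interior (C k) \<noteq> {}"
    then have "Met_TC.mtopology interior_of (\<Union>(range C)) = {}"
      by (intro Met_TC.metric_Baire_category_alt)
         (use closed in \<open>auto simp: complete_UNIV\<close>)
    then show False using cover by simp
  qed
  then obtain k x0 where "x0 \<in> interior (C k)" by blast
  then obtain r where r: "0 < r" "cball x0 r \<subseteq> C k"
    by (meson interior_subset mem_interior_cball order_trans)
  show ?thesis
  proof (rule that[of "2 * real k / r"])
    show "0 \<le> 2 * real k / r" using r by simp
    fix n x
    show "norm (f n x) \<le> 2 * real k / r * norm x"
    proof (cases "x = 0")
      case True then show ?thesis using linear_0[OF bounded_linear.linear[OF lin]] by simp
    next
      case False
      define z where "z = (r / norm x) *\<^sub>R x"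
      have "norm z = r" using False r by (simp add: z_def)
      then have "x0 + z \<in> C k" "x0 \<in> C k"
        using r by (auto simp: subset_iff mem_cball dist_norm)
      then have "norm (f n (x0 + z)) \<le> k" "norm (f n x0) \<le> k" by (auto simp: C_def)
      moreover have "f n z = f n (x0 + z) - f n x0"
        by (simp add: linear_add[OF bounded_linear.linear[OF lin]])
      ultimately have "norm (f n z) \<le> 2 * k"
        using norm_triangle_ineq4[of "f n (x0 + z)" "f n x0"] by simp
      moreover have "f n z = (r / norm x) *\<^sub>R f n x"
        by (simp add: z_def linear_scale[OF bounded_linear.linear[OF lin]])
      ultimately show ?thesis using r False by (simp add: field_simps)
    qed
  qed
qed

section \<open>Strongly continuous semigroups: local boundedness, continuous orbits and their
  integrals\<close>

locale c0_semigroup =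
  fixes S :: "real \<Rightarrow> 'a::banach \<Rightarrow> 'a"
  assumes C0: "C0_semigroup S"
begin

lemma bounded_linear_S: "0 \<le> t \<Longrightarrow> bounded_linear (S t)"
  and S_0 [simp]: "S 0 x = x"
  and S_add: "0 \<le> s \<Longrightarrow> 0 \<le> t \<Longrightarrow> S (s + t) x = S s (S t x)"
  and S_tendsto: "((\<lambda>t. S t x) \<longlongrightarrow> x) (at_right 0)"
  using C0 by (auto simp: C0_semigroup_def)

lemma linear_S: "0 \<le> t \<Longrightarrow> linear (S t)"
  by (rule bounded_linear.linear[OF bounded_linear_S])

lemma S_near_0:
  assumes "0 < e"
  obtains d where "0 < d" "\<And>t. 0 \<le> t \<Longrightarrow> t < d \<Longrightarrow> norm (S t x - x) < e"
proof -
  have "eventually (\<lambda>t. dist (S t x) x < e) (at_right 0)"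
    using tendstoD[OF S_tendsto assms] .
  then obtain d where "0 < d" "\<And>t. 0 < t \<Longrightarrow> t < d \<Longrightarrow> dist (S t x) x < e"
    by (auto simp: eventually_at_right_field)
  then show ?thesis using assms
    by (intro that[of d]) (auto simp: dist_norm dest: le_imp_less_or_eq)
qed

text \<open>If this failed on every interval at \<open>0\<close>, there would be times
  \<open>t n\<close> tending to \<open>0\<close> at which the bound \<open>n\<close> is violated.
  Strong continuity bounds each orbit along these times, so Banach-Steinhaus gives a
  contradiction.\<close>

lemma bounded_near_0:
  obtains d M where "0 < d" "0 \<le> M" "\<And>t x. 0 \<le> t \<Longrightarrow> t \<le> d \<Longrightarrow> norm (S t x) \<le> M * norm x"
proof -
  have "\<exists>n::nat. \<forall>t x. 0 \<le> t \<longrightarrow> t \<le> 1 / Suc n \<longrightarrow> norm (S t x) \<le> real n * norm x"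
  proof (rule ccontr)
    assume "\<not> ?thesis"
    then have "\<forall>n::nat. \<exists>t. 0 \<le> t \<and> t \<le> 1 / Suc n \<and> (\<exists>x. norm (S t x) > real n * norm x)"
      by (auto simp: not_le)
    then obtain t where t: "\<And>n::nat. 0 \<le> t n" "\<And>n. t n \<le> 1 / Suc n"
      and x: "\<And>n. \<exists>x. norm (S (t n) x) > real n * norm x"
      by metis
    obtain K where K: "\<And>n x. norm (S (t n) x) \<le> K * norm x"
    proof (rule uniform_boundedness[of "\<lambda>n. S (t n)"])
      show "bounded_linear (S (t n))" for n using t(1) by (rule bounded_linear_S)
      show "\<exists>K. \<forall>n. norm (S (t n) x) \<le> K" for x
      proof -
        obtain d where d: "0 < d" "\<And>t. 0 \<le> t \<Longrightarrow> t < d \<Longrightarrow> norm (S t x - x) < 1"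
          using S_near_0[of 1 x] by auto
        obtain N :: nat where N: "inverse (Suc N) < d"
          using reals_Archimedean d(1) by blast
        \<comment> \<open>The sum covers the finitely many times that may lie beyond
          \<open>d\<close>; at the later ones the orbit is within distance \<open>1\<close> of
          \<open>x\<close>.\<close>
        have "norm (S (t n) x) \<le> norm x + 1 + (\<Sum>i\<le>N. norm (S (t i) x))" for n
        proof (cases "n \<le> N")
          case True
          then have "norm (S (t n) x) \<le> (\<Sum>i\<le>N. norm (S (t i) x))"
            by (intro member_le_sum) auto
          then show ?thesis using norm_ge_zero[of x] by linarith
        next
          case False
          then have "1 / real (Suc n) \<le> inverse (Suc N)"
            by (simp add: field_simps)
          then have "t n < d" using t(2)[of n] N by linarith
          then have "norm (S (t n) x - x) < 1" using d t(1) by blast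
          moreover have "norm (S (t n) x) \<le> norm (S (t n) x - x) + norm x"
            using norm_triangle_sub[of "S (t n) x" x] by linarith
          moreover have "0 \<le> (\<Sum>i\<le>N. norm (S (t i) x))" by (simp add: sum_nonneg)
          ultimately show ?thesis by linarith
        qed
        then show ?thesis by blast
      qed
    qed auto
    obtain n :: nat where "K \<le> real n" using real_arch_simple by blast
    moreover obtain y where "norm (S (t n) y) > real n * norm y" using x by blast
    ultimately show False
      using K[of n y] mult_right_mono[of K "real n" "norm y"] by simp
  qed
  then obtain n :: nat where "\<And>t x. 0 \<le> t \<Longrightarrow> t \<le> 1 / Suc n \<Longrightarrow> norm (S t x) \<le> real n * norm x"
    by blast
  then show ?thesis by (intro that[of "1 / Suc n" "real n"]) auto
qed

text \<open>Iterates the local bound in steps of length \<open>d\<close>; \<open>max 1 M\<close>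
  keeps the powers increasing.\<close>

lemma bounded_on_compact:
  obtains M where "0 \<le> M" "\<And>t x. 0 \<le> t \<Longrightarrow> t \<le> T \<Longrightarrow> norm (S t x) \<le> M * norm x"
proof -
  obtain d M where d: "0 < d" and M: "0 \<le> M"
    and dM: "\<And>t x. 0 \<le> t \<Longrightarrow> t \<le> d \<Longrightarrow> norm (S t x) \<le> M * norm x"
    using bounded_near_0 by blast
  have step: "norm (S t x) \<le> (max 1 M) ^ n * norm x" if "0 \<le> t" "t \<le> real n * d" for n t x
    using that
  proof (induction n arbitrary: t)
    case (Suc n)
    show ?case
    proof (cases "t \<le> d")
      case True
      then have "norm (S t x) \<le> M * norm x" using dM Suc by blast
      also have "\<dots> \<le> (max 1 M) ^ Suc n * norm x"
        using self_le_power[of "max 1 M" "Suc n"] by (intro mult_right_mono) auto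
      finally show ?thesis .
    next
      case False
      have "t - d \<le> real n * d" using Suc.prems(2) by (simp add: algebra_simps)
      then have "norm (S (t - d) x) \<le> (max 1 M) ^ n * norm x"
        using Suc.IH[of "t - d"] False by auto
      moreover have "S t x = S d (S (t - d) x)" using S_add[of d "t - d" x] d False by simp
      ultimately have "norm (S t x) \<le> M * norm (S (t - d) x)" using dM d by simp
      also have "\<dots> \<le> max 1 M * ((max 1 M) ^ n * norm x)"
        using \<open>norm (S (t - d) x) \<le> _\<close> by (intro mult_mono) auto
      finally show ?thesis by simp
    qed
  qed simp
  obtain n :: nat where "T / d \<le> real n" using real_arch_simple by blast
  then have "T \<le> real n * d" using d by (simp add: field_simps)
  then show ?thesis using step by (intro that[of "(max 1 M) ^ n"]) force+
qed

text \<open>Both one-sided limits reduce to continuity at \<open>0\<close> by factoring out the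
  operator at the smaller time. For the left limit that time varies, hence the bound uniform near
  \<open>t0\<close>.\<close>

lemma continuous_on_S: "continuous_on {0..} (\<lambda>t. S t x)"
proof (rule continuous_onI)
  fix t0 e :: real assume "t0 \<in> {0..}" "0 < e"
  then have t0: "0 \<le> t0" by simp
  obtain M where M: "0 \<le> M" "\<And>t x. 0 \<le> t \<Longrightarrow> t \<le> t0 + 1 \<Longrightarrow> norm (S t x) \<le> M * norm x"
    using bounded_on_compact by blast
  obtain d where d: "0 < d" "\<And>t. 0 \<le> t \<Longrightarrow> t < d \<Longrightarrow> norm (S t x - x) < e / (M + 1)"
    using S_near_0[of "e / (M + 1)" x] \<open>0 < e\<close> M(1) by auto
  have key: "norm (S t x - S s x) \<le> e"
    if "0 \<le> s" "s \<le> t" "s \<le> t0 + 1" "t - s < d" for s t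
  proof -
    have "S t x - S s x = S s (S (t - s) x - x)"
      using S_add[of s "t - s" x] that linear_diff[OF linear_S[OF that(1)]] by simp
    then have "norm (S t x - S s x) \<le> M * norm (S (t - s) x - x)" using M that by simp
    also have "\<dots> \<le> (M + 1) * (e / (M + 1))"
      using d(2)[of "t - s"] that M(1) by (intro mult_mono) auto
    finally show ?thesis using M(1) by simp
  qed
  show "\<exists>d>0. \<forall>t\<in>{0..}. dist t t0 < d \<longrightarrow> dist (S t x) (S t0 x) \<le> e"
  proof (intro exI[of _ "min d 1"] conjI ballI impI)
    show "0 < min d 1" using d by simp
    fix t :: real assume "t \<in> {0..}" "dist t t0 < min d 1"
    then show "dist (S t x) (S t0 x) \<le> e"
      using key[of t0 t] key[of t t0] t0
      by (cases "t0 \<le> t") (auto simp: dist_norm norm_minus_commute)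
  qed
qed

text \<open>The value at time \<open>t\<close> of the solution of u' = A u + v, u(0) = 0, for the
  generator A and a constant source \<open>v\<close>. It lies in the domain for every
  \<open>v\<close>, which supplies both density of the domain and the explicit steps of the
  scheme.\<close>

definition J :: "real \<Rightarrow> 'a \<Rightarrow> 'a" where "J t v = integral {0..t} (\<lambda>r. S r v)"

lemma integrable_S: "0 \<le> a \<Longrightarrow> (\<lambda>r. S r v) integrable_on {a..b}"
  by (intro integrable_continuous_real continuous_on_subset[OF continuous_on_S]) auto

lemma J_0 [simp]: "J 0 v = 0"
  by (simp add: J_def)

text \<open>Splits the integral at \<open>s\<close> and pulls \<open>S s\<close> out of the shifted
  tail.\<close>

lemma J_add:
  assumes "0 \<le> s" "0 \<le> t"
  shows "J (s + t) v = J s v + S s (J t v)"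
proof -
  have "S s (J t v) = integral {0..t} (S s \<circ> (\<lambda>r. S r v))"
    unfolding J_def using assms by (intro integral_linear[symmetric] integrable_S bounded_linear_S) auto
  also have "\<dots> = integral {0..t} ((\<lambda>r. S r v) \<circ> (+) s)"
    using assms by (intro integral_cong) (auto simp: S_add)
  also have "\<dots> = integral {0 + s..t + s} (\<lambda>r. S r v)"
    by (rule integral_shift_Icc_real)
  finally show ?thesis
    using Henstock_Kurzweil_Integration.integral_combine[where a = 0 and c = s and b = "s + t" and f = "\<lambda>r. S r v"] assms integrable_S[of 0]
    by (simp add: J_def add.commute)
qed

text \<open>Taken within \<open>{0..}\<close>, since nothing is known about \<open>S\<close> at
  negative times; the one-sided case at \<open>0\<close> yields the convergence of the
  averages.\<close>

lemma J_has_vector_derivative_within: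
  assumes "0 \<le> t"
  shows "((\<lambda>t. J t v) has_vector_derivative S t v) (at t within {0..})"
proof -
  have "((\<lambda>t. J t v) has_vector_derivative S t v) (at t within {0..t + 1})"
    unfolding J_def using assms
    by (intro integral_has_vector_derivative continuous_on_subset[OF continuous_on_S]) auto
  moreover have "at t within {0..t + 1} = at t within {0..}"
    by (rule at_within_nhd[of _ "{..<t + 1}"]) (use assms in auto)
  ultimately show ?thesis by simp
qed

lemma J_has_vector_derivative:
  assumes "0 < t"
  shows "((\<lambda>t. J t v) has_vector_derivative S t v) (at t)"
proof -
  have "at t within {0..} = at t" using assms by (intro at_within_interior) simp
  then show ?thesis using J_has_vector_derivative_within[of t v] assms by simp
qed

lemma J_tendsto: "((\<lambda>h. J h v /\<^sub>R h) \<longlongrightarrow> v) (at_right 0)"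
proof -
  have "((\<lambda>t. J t v) has_vector_derivative v) (at_right 0)"
    using J_has_vector_derivative_within[of 0 v]
    by (auto intro: has_vector_derivative_within_subset)
  then have "((\<lambda>h. (1 / norm h) *\<^sub>R (J h v - h *\<^sub>R v)) \<longlongrightarrow> 0) (at_right 0)"
    by (simp add: has_vector_derivative_def has_derivative_within)
  moreover have "(1 / norm h) *\<^sub>R (J h v - h *\<^sub>R v) = J h v /\<^sub>R h - v" if "0 < h" for h
    using that by (simp add: scaleR_diff_right divide_inverse)
  ultimately have "((\<lambda>h. J h v /\<^sub>R h - v) \<longlongrightarrow> 0) (at_right 0)"
    by (elim Lim_transform_eventually) (auto intro!: eventually_at_rightI[of 0 1])
  then show ?thesis by (rule LIM_zero_cancel)
qed

text \<open>Expanding \<open>J (t + h) v\<close> in both orders shows that \<open>S h - I\<close> on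
  \<open>J t v\<close> equals \<open>S t - I\<close> on \<open>J h v\<close>. The difference
  quotient is therefore \<open>S t - I\<close> applied to an average that tends to
  \<open>v\<close>.\<close>

lemma J_derivative_0:
  assumes "0 \<le> t"
  shows "((\<lambda>h. (S h (J t v) - J t v) /\<^sub>R h) \<longlongrightarrow> S t v - v) (at_right 0)"
proof -
  have "((\<lambda>h. S t (J h v /\<^sub>R h) - J h v /\<^sub>R h) \<longlongrightarrow> S t v - v) (at_right 0)"
    using assms by (intro tendsto_intros bounded_linear.tendsto[OF bounded_linear_S] J_tendsto)
  moreover have "S t (J h v /\<^sub>R h) - J h v /\<^sub>R h = (S h (J t v) - J t v) /\<^sub>R h" if "0 < h" for h
  proof -
    have "J t v + S t (J h v) = J h v + S h (J t v)"
      using J_add[of t h v] J_add[of h t v] assms that by (simp add: add.commute)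
    then have "S t (J h v) - J h v = S h (J t v) - J t v" by (simp add: algebra_simps)
    then show ?thesis
      using linear_scale[OF linear_S[OF assms]] by (metis scaleR_diff_right)
  qed
  ultimately show ?thesis
    by (elim Lim_transform_eventually) (auto intro!: eventually_at_rightI[of 0 1])
qed

end

section \<open>The generator, its domain and the exponential growth bound\<close>

locale quasi_contractive_semigroup =
  fixes D :: "'a::{real_inner, banach} set" and A :: "'a \<Rightarrow> 'a" and S :: "real \<Rightarrow> 'a \<Rightarrow> 'a"
    and \<omega> :: real
  assumes generates: "generates D A S"
    and dissipative: "\<And>x. x \<in> D \<Longrightarrow> A x \<bullet> x \<le> \<omega> * (norm x)\<^sup>2"
    and \<omega>_nonneg: "0 \<le> \<omega>"

sublocale quasi_contractive_semigroup \<subseteq> c0_semigroup S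
  using generates by unfold_locales (simp add: generates_def)

context quasi_contractive_semigroup
begin

lemma domain_tendsto: "x \<in> D \<Longrightarrow> ((\<lambda>t. (S t x - x) /\<^sub>R t) \<longlongrightarrow> A x) (at_right 0)"
  using generates by (simp add: generates_def)

lemma domainI:
  assumes "((\<lambda>t. (S t x - x) /\<^sub>R t) \<longlongrightarrow> l) (at_right 0)"
  shows "x \<in> D" and "A x = l"
proof -
  show "x \<in> D" using assms generates by (auto simp: generates_def)
  then show "A x = l" using domain_tendsto assms tendsto_unique by (metis trivial_limit_at_right_real)
qed

lemma linear_combination_domain:
  assumes "x \<in> D" "z \<in> D"
  shows "a *\<^sub>R x + b *\<^sub>R z \<in> D" and "A (a *\<^sub>R x + b *\<^sub>R z) = a *\<^sub>R A x + b *\<^sub>R A z"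
proof -
  have "((\<lambda>t. a *\<^sub>R ((S t x - x) /\<^sub>R t) + b *\<^sub>R ((S t z - z) /\<^sub>R t)) \<longlongrightarrow> a *\<^sub>R A x + b *\<^sub>R A z) (at_right 0)"
    using assms by (intro tendsto_intros domain_tendsto)
  moreover have "a *\<^sub>R ((S t x - x) /\<^sub>R t) + b *\<^sub>R ((S t z - z) /\<^sub>R t)
      = (S t (a *\<^sub>R x + b *\<^sub>R z) - (a *\<^sub>R x + b *\<^sub>R z)) /\<^sub>R t" if "0 < t" for t
    using linear_S[of t] that
    by (simp add: linear_add linear_scale scaleR_diff_right scaleR_add_right mult.commute)
  ultimately have "((\<lambda>t. (S t (a *\<^sub>R x + b *\<^sub>R z) - (a *\<^sub>R x + b *\<^sub>R z)) /\<^sub>R t) \<longlongrightarrow> a *\<^sub>R A x + b *\<^sub>R A z) (at_right 0)"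
    by (elim Lim_transform_eventually) (auto intro!: eventually_at_rightI[of 0 1])
  then show "a *\<^sub>R x + b *\<^sub>R z \<in> D" "A (a *\<^sub>R x + b *\<^sub>R z) = a *\<^sub>R A x + b *\<^sub>R A z"
    by (rule domainI)+
qed

lemma add_domain: "x \<in> D \<Longrightarrow> z \<in> D \<Longrightarrow> x + z \<in> D \<and> A (x + z) = A x + A z"
  using linear_combination_domain[of x z 1 1] by simp

lemma diff_domain: "x \<in> D \<Longrightarrow> z \<in> D \<Longrightarrow> x - z \<in> D \<and> A (x - z) = A x - A z"
  using linear_combination_domain[of x z 1 "-1"] by simp

lemma J_domain: "0 \<le> t \<Longrightarrow> J t v \<in> D \<and> A (J t v) = S t v - v"
  using domainI[OF J_derivative_0] by simp

text \<open>The averages \<open>J h x /\<^sub>R h\<close> lie in the domain and tend to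
  \<open>x\<close>.\<close>

lemma domain_dense:
  assumes "0 < e"
  obtains z where "z \<in> D" "norm (z - x) < e"
proof -
  have "\<forall>\<^sub>F h in at_right 0. dist (J h x /\<^sub>R h) x < e \<and> 0 < h"
    using tendstoD[OF J_tendsto assms] by (auto simp: eventually_conj_iff eventually_at_right_less)
  then obtain h where "dist (J h x /\<^sub>R h) x < e" "0 < h"
    using eventually_happens' [OF trivial_limit_at_right_real] by blast
  then show ?thesis
    using linear_combination_domain(1)[of "J h x" "J h x" "inverse h" 0] J_domain[of h x]
    by (intro that[of "J h x /\<^sub>R h"]) (auto simp: dist_norm)
qed

text \<open>Dissipativity gives a differential inequality for the squared norm along differentiable
  orbits in the domain. Orbits starting at \<open>J h x\<close> are of this kind, being differences
  of two values of \<open>J\<close>; the averages then extend the bound to every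
  \<open>x\<close>.\<close>

lemma norm_S_le:
  assumes "0 \<le> t"
  shows "norm (S t x) \<le> exp (\<omega> * t) * norm x"
proof -
  have J: "norm (S t (J h x)) \<le> exp (\<omega> * t) * norm (J h x)" if "0 < h" for h
  proof -
    define u where "u r = J (r + h) x - J r x" for r
    have u_eq: "u r = S r (J h x)" if "0 \<le> r" for r
      using J_add[of r h x] that \<open>0 < h\<close> by (simp add: u_def)
    define H where "H r = exp (- 2 * \<omega> * r) * (u r \<bullet> u r)" for r
    have "H t \<le> H 0"
    proof (rule DERIV_nonpos_imp_decreasing_open[OF assms])
      fix r assume r: "0 < r" "r < t"
      have "((\<lambda>r. J (r + h) x) has_vector_derivative S (r + h) x) (at r)"
        using vector_diff_chain_at[of "\<lambda>r. r + h" 1 r "\<lambda>r. J r x" "S (r + h) x"]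
          J_has_vector_derivative[of "r + h" x] r \<open>0 < h\<close>
          has_vector_derivative_add[OF has_vector_derivative_id has_vector_derivative_const]
        by (simp add: o_def)
      then have "(u has_vector_derivative (S (r + h) x - S r x)) (at r)"
        unfolding u_def using r by (intro has_vector_derivative_diff J_has_vector_derivative) auto
      moreover have uD: "u r \<in> D \<and> A (u r) = S (r + h) x - S r x"
        using diff_domain[of "J (r + h) x" "J r x"] J_domain[of "r + h" x] J_domain[of r x] r \<open>0 < h\<close>
        by (simp add: u_def)
      ultimately have "(u has_derivative (\<lambda>s. s *\<^sub>R A (u r))) (at r)"
        by (simp add: has_vector_derivative_def)
      from has_derivative_inner[OF this this]
      have "((\<lambda>r. u r \<bullet> u r) has_real_derivative 2 * (A (u r) \<bullet> u r)) (at r)"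
        unfolding has_field_derivative_def
        by (rule has_derivative_eq_rhs) (auto simp: inner_commute algebra_simps)
      moreover have "((\<lambda>r. exp (- 2 * \<omega> * r)) has_real_derivative - 2 * \<omega> * exp (- 2 * \<omega> * r)) (at r)"
        by (auto intro!: derivative_eq_intros)
      ultimately have "(H has_real_derivative
          exp (- 2 * \<omega> * r) * (2 * (A (u r) \<bullet> u r)) + - 2 * \<omega> * exp (- 2 * \<omega> * r) * (u r \<bullet> u r)) (at r)"
        unfolding H_def by (auto intro!: derivative_eq_intros)
      moreover have "exp (- 2 * \<omega> * r) * (2 * (A (u r) \<bullet> u r)) + - 2 * \<omega> * exp (- 2 * \<omega> * r) * (u r \<bullet> u r)
          = 2 * exp (- 2 * \<omega> * r) * (A (u r) \<bullet> u r - \<omega> * (u r \<bullet> u r))"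
        by (simp add: algebra_simps)
      moreover have "\<dots> \<le> 0"
        using dissipative[of "u r"] uD by (intro mult_nonneg_nonpos) (auto simp: dot_square_norm)
      ultimately show "\<exists>y. (H has_real_derivative y) (at r) \<and> y \<le> 0" by metis
    next
      have "continuous_on {0..t} (\<lambda>r. S r (J h x))"
        by (rule continuous_on_subset[OF continuous_on_S]) simp
      then have "continuous_on {0..t} u"
        by (rule continuous_on_eq) (simp add: u_eq)
      then show "continuous_on {0..t} H" unfolding H_def by (intro continuous_intros)
    qed
    then have "exp (- 2 * \<omega> * t) * (norm (S t (J h x)))\<^sup>2 \<le> (norm (J h x))\<^sup>2"
      using assms by (simp add: H_def u_eq dot_square_norm)
    then have "(norm (S t (J h x)))\<^sup>2 \<le> exp (2 * \<omega> * t) * (norm (J h x))\<^sup>2"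
      by (simp add: exp_minus field_simps)
    also have "\<dots> = (exp (\<omega> * t) * norm (J h x))\<^sup>2"
      by (simp add: power_mult_distrib exp_double[symmetric] mult.assoc)
    finally show ?thesis by (rule power2_le_imp_le) simp
  qed
  have "((\<lambda>h. norm (S t (J h x /\<^sub>R h))) \<longlongrightarrow> norm (S t x)) (at_right 0)"
    using assms by (intro tendsto_intros bounded_linear.tendsto[OF bounded_linear_S] J_tendsto)
  moreover have "((\<lambda>h. exp (\<omega> * t) * norm (J h x /\<^sub>R h)) \<longlongrightarrow> exp (\<omega> * t) * norm x) (at_right 0)"
    by (intro tendsto_intros J_tendsto)
  moreover have "\<forall>\<^sub>F h in at_right 0. norm (S t (J h x /\<^sub>R h)) \<le> exp (\<omega> * t) * norm (J h x /\<^sub>R h)"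
  proof (rule eventually_at_rightI[of 0 1])
    fix h :: real assume "h \<in> {0<..<1}"
    then show "norm (S t (J h x /\<^sub>R h)) \<le> exp (\<omega> * t) * norm (J h x /\<^sub>R h)"
      using J[of h] linear_scale[OF linear_S[OF assms]] by (simp add: field_simps)
  qed simp
  ultimately show ?thesis by (intro tendsto_le[OF trivial_limit_at_right_real])
qed

lemma norm_J_le:
  assumes "0 \<le> t"
  shows "norm (J t v) \<le> t * exp (\<omega> * t) * norm v"
proof -
  have "norm (integral {0..t} (\<lambda>r. S r v)) \<le> exp (\<omega> * t) * norm v * (t - 0)"
  proof (rule integral_bound[OF assms])
    show "continuous_on {0..t} (\<lambda>r. S r v)"
      by (rule continuous_on_subset[OF continuous_on_S]) simp
    fix r assume r: "r \<in> {0..t}"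
    then have "norm (S r v) \<le> exp (\<omega> * r) * norm v" by (simp add: norm_S_le)
    also have "\<dots> \<le> exp (\<omega> * t) * norm v"
      using r \<omega>_nonneg by (intro mult_right_mono) (auto intro: mult_left_mono)
    finally show "norm (S r v) \<le> exp (\<omega> * t) * norm v" .
  qed
  then show ?thesis by (simp add: J_def mult_ac)
qed

lemma norm_J_diff_le:
  assumes "0 \<le> s" "s \<le> t"
  shows "norm (J t v - J s v) \<le> (t - s) * exp (\<omega> * t) * norm v"
proof -
  have "J t v - J s v = S s (J (t - s) v)" using J_add[of s "t - s" v] assms by simp
  then have "norm (J t v - J s v) \<le> exp (\<omega> * s) * norm (J (t - s) v)"
    using norm_S_le[OF assms(1)] by simp
  also have "\<dots> \<le> exp (\<omega> * s) * ((t - s) * exp (\<omega> * (t - s)) * norm v)"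
    using assms by (intro mult_left_mono norm_J_le) auto
  also have "\<dots> = (t - s) * (exp (\<omega> * s) * exp (\<omega> * (t - s))) * norm v" by simp
  also have "exp (\<omega> * s) * exp (\<omega> * (t - s)) = exp (\<omega> * t)"
    by (simp add: exp_add[symmetric] algebra_simps)
  finally show ?thesis .
qed

end

section \<open>The scheme with frozen nonlinearity\<close>

locale semilinear_scheme = quasi_contractive_semigroup +
  fixes G :: "'a \<Rightarrow> 'a" and L \<tau> :: real and x0 :: 'a
  assumes Lipschitz: "\<And>u v. norm (G u - G v) \<le> L * norm (u - v)" and L_nonneg: "0 \<le> L"
    and \<tau>_pos: "0 < \<tau>" and x0_domain: "x0 \<in> D"
begin

text \<open>One step solves u' = A u - G (node k) exactly: with
  \<open>v = A (node k) - G (node k)\<close>, the path \<open>node k + J r v\<close> has derivative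
  \<open>S r v\<close>, and \<open>A\<close> maps it to \<open>G (node k) + S r v\<close>.\<close>

primrec node :: "nat \<Rightarrow> 'a" where
  "node 0 = x0"
| "node (Suc k) = node k + J \<tau> (A (node k) - G (node k))"

definition velocity :: "nat \<Rightarrow> 'a" where "velocity k = A (node k) - G (node k)"

definition step :: "real \<Rightarrow> nat" where "step t = nat \<lfloor>t / \<tau>\<rfloor>"

definition trajectory :: "real \<Rightarrow> 'a" where
  "trajectory t = node (step t) + J (t - step t * \<tau>) (velocity (step t))"

text \<open>A Lipschitz constant of the trajectory up to time \<open>T\<close>: a bound on the nodal
  velocities, times the growth within one step. It depends on \<open>\<tau>\<close> only through
  \<open>exp (\<omega> * \<tau>)\<close>.\<close>

definition growth :: "real \<Rightarrow> real" where
  "growth T = exp (\<omega> * \<tau>) * (exp ((\<omega> + L) * T) * norm (velocity 0))"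

lemma node_domain: "node k \<in> D"
  using \<tau>_pos by (induction k) (simp_all add: x0_domain add_domain J_domain)

lemma step_bounds:
  assumes "0 \<le> t"
  shows "step t * \<tau> \<le> t" and "t < (real (step t) + 1) * \<tau>"
proof -
  have "real (step t) = real_of_int \<lfloor>t / \<tau>\<rfloor>" using assms \<tau>_pos by (simp add: step_def)
  then have "real (step t) \<le> t / \<tau>" "t / \<tau> < real (step t) + 1" by linarith+
  then show "step t * \<tau> \<le> t" "t < (real (step t) + 1) * \<tau>"
    using \<tau>_pos by (simp_all only: pos_le_divide_eq pos_divide_less_eq)
qed

lemma step_eq:
  assumes "k * \<tau> \<le> t" "t < (real k + 1) * \<tau>"
  shows "step t = k"
proof -
  have "\<lfloor>t / \<tau>\<rfloor> = int k"
    using assms \<tau>_pos by (intro floor_unique) (auto simp: field_simps)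
  then show ?thesis by (simp add: step_def)
qed

lemma velocity_Suc: "velocity (Suc k) = S \<tau> (velocity k) + (G (node k) - G (node (Suc k)))"
  using add_domain[OF node_domain[of k], of "J \<tau> (velocity k)"] J_domain[of \<tau> "velocity k"] \<tau>_pos
  by (simp add: velocity_def)

lemma norm_velocity_le: "norm (velocity k) \<le> exp ((\<omega> + L) * (k * \<tau>)) * norm (velocity 0)"
proof (induction k)
  case (Suc k)
  have "norm (G (node k) - G (node (Suc k))) \<le> L * norm (J \<tau> (velocity k))"
    using Lipschitz[of "node k" "node (Suc k)"] by (simp add: velocity_def)
  also have "\<dots> \<le> L * (\<tau> * exp (\<omega> * \<tau>) * norm (velocity k))"
    using \<tau>_pos L_nonneg by (intro mult_left_mono norm_J_le) auto
  finally have "norm (velocity (Suc k)) \<le>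
      exp (\<omega> * \<tau>) * norm (velocity k) + L * (\<tau> * exp (\<omega> * \<tau>) * norm (velocity k))"
    unfolding velocity_Suc using norm_S_le[of \<tau> "velocity k"] \<tau>_pos
    by (intro norm_triangle_le add_mono) auto
  also have "\<dots> = (1 + L * \<tau>) * (exp (\<omega> * \<tau>) * norm (velocity k))"
    by (simp add: algebra_simps)
  also have "\<dots> \<le> exp (L * \<tau>) * (exp (\<omega> * \<tau>) * (exp ((\<omega> + L) * (k * \<tau>)) * norm (velocity 0)))"
    using Suc.IH L_nonneg \<tau>_pos exp_ge_add_one_self[of "L * \<tau>"] by (intro mult_mono) auto
  also have "\<dots> = exp (L * \<tau> + \<omega> * \<tau> + (\<omega> + L) * (k * \<tau>)) * norm (velocity 0)"
    by (simp add: exp_add)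
  also have "L * \<tau> + \<omega> * \<tau> + (\<omega> + L) * (k * \<tau>) = (\<omega> + L) * (Suc k * \<tau>)"
    by (simp add: algebra_simps)
  finally show ?case .
qed simp

text \<open>Includes the right endpoint, where \<open>step\<close> has already jumped; the recursion
  for \<open>node\<close> makes the two formulas agree there, so consecutive pieces fit
  together.\<close>

lemma trajectory_eq:
  assumes "k * \<tau> \<le> t" "t \<le> (real k + 1) * \<tau>"
  shows "trajectory t = node k + J (t - k * \<tau>) (velocity k)"
proof (cases "t < (real k + 1) * \<tau>")
  case True
  then show ?thesis using step_eq[OF assms(1)] by (simp add: trajectory_def)
next
  case False
  then have t: "t = (real k + 1) * \<tau>" using assms by simp
  then have "step t = Suc k" using \<tau>_pos by (intro step_eq) (auto simp: algebra_simps)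
  then show ?thesis using t by (simp add: trajectory_def velocity_def algebra_simps)
qed

lemma trajectory_0: "trajectory 0 = x0"
  using trajectory_eq[of 0 0] \<tau>_pos by simp

lemma growth_nonneg: "0 \<le> growth T"
  by (simp add: growth_def)

lemma trajectory_piece_Lipschitz:
  assumes "k * \<tau> \<le> s" "s \<le> t" "t \<le> (real k + 1) * \<tau>" "k * \<tau> \<le> T"
  shows "norm (trajectory t - trajectory s) \<le> growth T * (t - s)"
proof -
  have "trajectory t - trajectory s = J (t - k * \<tau>) (velocity k) - J (s - k * \<tau>) (velocity k)"
    using trajectory_eq[of k t] trajectory_eq[of k s] assms by simp
  also have "norm \<dots> \<le> ((t - k * \<tau>) - (s - k * \<tau>)) * exp (\<omega> * (t - k * \<tau>)) * norm (velocity k)"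
    using assms by (intro norm_J_diff_le) auto
  also have "\<dots> \<le> (t - s) * exp (\<omega> * \<tau>) * (exp ((\<omega> + L) * T) * norm (velocity 0))"
  proof (intro mult_mono)
    show "exp (\<omega> * (t - k * \<tau>)) \<le> exp (\<omega> * \<tau>)"
      using assms \<omega>_nonneg mult_left_mono[of "t - k * \<tau>" \<tau> \<omega>] by (simp add: algebra_simps)
    have "(\<omega> + L) * (k * \<tau>) \<le> (\<omega> + L) * T"
      using assms \<omega>_nonneg L_nonneg by (intro mult_left_mono) auto
    then show "norm (velocity k) \<le> exp ((\<omega> + L) * T) * norm (velocity 0)"
      by (intro order_trans[OF norm_velocity_le] mult_right_mono) auto
  qed (use assms in auto)
  finally show ?thesis by (simp add: growth_def mult_ac)
qed

text \<open>Induction on the number of steps, joining the pieces at the last node.\<close>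

lemma trajectory_Lipschitz:
  assumes "0 \<le> s" "s \<le> t" "t \<le> T"
  shows "norm (trajectory t - trajectory s) \<le> growth T * (t - s)"
proof -
  have "norm (trajectory t - trajectory s) \<le> growth T * (t - s)" if "0 \<le> s" "s \<le> t" "t \<le> n * \<tau>" "t \<le> T" for n :: nat and s t
    using that
  proof (induction n arbitrary: s t)
    case (Suc n)
    have le: "t \<le> (real n + 1) * \<tau>" using Suc.prems by (simp add: algebra_simps)
    consider "t \<le> n * \<tau>" | "n * \<tau> \<le> s" "n * \<tau> \<le> t" | "s < n * \<tau>" "n * \<tau> < t" by linarith
    then show ?case
    proof cases
      case 1
      then show ?thesis using Suc by blast
    next
      case 2
      then show ?thesis using Suc.prems le by (intro trajectory_piece_Lipschitz) auto
    next
      case 3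
      have "norm (trajectory t - trajectory (n * \<tau>)) \<le> growth T * (t - n * \<tau>)"
        using 3 le Suc.prems by (intro trajectory_piece_Lipschitz) auto
      moreover have "norm (trajectory (n * \<tau>) - trajectory s) \<le> growth T * (n * \<tau> - s)"
        using 3 Suc.prems by (intro Suc.IH) auto
      moreover have "norm (trajectory t - trajectory s) \<le> norm (trajectory t - trajectory (n * \<tau>)) + norm (trajectory (n * \<tau>) - trajectory s)"
        using norm_triangle_ineq[of "trajectory t - trajectory (n * \<tau>)" "trajectory (n * \<tau>) - trajectory s"] by simp
      moreover have "growth T * (t - n * \<tau>) + growth T * (n * \<tau> - s) = growth T * (t - s)"
        by (simp add: algebra_simps)
      ultimately show ?thesis by linarith
    qed
  next
    case 0
    then have "s = t" by simp
    then show ?case by simp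
  qed
  moreover obtain n :: nat where "t / \<tau> \<le> real n" using real_arch_simple by blast
  then have "t \<le> n * \<tau>" using \<tau>_pos by (simp add: field_simps)
  ultimately show ?thesis using assms by blast
qed

lemma continuous_on_path: "continuous_on {0..T} trajectory"
proof (rule lipschitz_on_continuous_on)
  show "(growth T)-lipschitz_on {0..T} trajectory"
  proof (rule lipschitz_onI[OF _ growth_nonneg])
    fix s t assume st: "s \<in> {0..T}" "t \<in> {0..T}"
    show "dist (trajectory s) (trajectory t) \<le> growth T * dist s t"
      using trajectory_Lipschitz[of s t T] trajectory_Lipschitz[of t s T] st
      by (cases "s \<le> t") (auto simp: dist_norm norm_minus_commute)
  qed
qed

lemma trajectory_domain:
  assumes "0 \<le> t"
  shows "trajectory t \<in> D"
    and "A (trajectory t) = G (node (step t)) + S (t - step t * \<tau>) (velocity (step t))"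
proof -
  have "0 \<le> t - step t * \<tau>" using step_bounds[OF assms] by simp
  note J = J_domain[OF this, of "velocity (step t)"]
  show "trajectory t \<in> D"
    unfolding trajectory_def using add_domain[OF node_domain] J by blast
  show "A (trajectory t) = G (node (step t)) + S (t - step t * \<tau>) (velocity (step t))"
    unfolding trajectory_def using add_domain[OF node_domain] J by (auto simp: velocity_def)
qed

lemma trajectory_derivative:
  assumes "0 < t" "t \<notin> range (\<lambda>k::nat. k * \<tau>)"
  shows "(trajectory has_vector_derivative (A (trajectory t) - G (node (step t)))) (at t)"
proof -
  let ?k = "step t"
  have "?k * \<tau> \<noteq> t" using assms(2) by (metis rangeI)
  then have k: "?k * \<tau> < t" "t < (real ?k + 1) * \<tau>"
    using step_bounds[of t] assms(1) by auto
  have "((\<lambda>u. J (u - ?k * \<tau>) (velocity ?k)) has_vector_derivative S (t - ?k * \<tau>) (velocity ?k)) (at t)"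
    using vector_diff_chain_at[of "\<lambda>u. u - ?k * \<tau>" 1 t "\<lambda>r. J r (velocity ?k)" "S (t - ?k * \<tau>) (velocity ?k)"]
      J_has_vector_derivative[of "t - ?k * \<tau>" "velocity ?k"] k
      has_vector_derivative_diff[OF has_vector_derivative_id has_vector_derivative_const]
    by (simp add: o_def)
  then have "((\<lambda>u. node ?k + J (u - ?k * \<tau>) (velocity ?k)) has_vector_derivative
      S (t - ?k * \<tau>) (velocity ?k)) (at t)"
    using has_vector_derivative_add[OF has_vector_derivative_const] by fastforce
  then have "(trajectory has_vector_derivative S (t - ?k * \<tau>) (velocity ?k)) (at t)"
  proof (rule has_vector_derivative_transform_within_open)
    show "open {?k * \<tau><..<(real ?k + 1) * \<tau>}" by simp
    show "t \<in> {?k * \<tau><..<(real ?k + 1) * \<tau>}" using k by simp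
    show "node ?k + J (u - ?k * \<tau>) (velocity ?k) = trajectory u"
      if "u \<in> {?k * \<tau><..<(real ?k + 1) * \<tau>}" for u
      using trajectory_eq[of ?k u] that by simp
  qed
  then show ?thesis using trajectory_domain(2)[of t] assms by simp
qed

lemma trajectory_node_close:
  assumes "t \<in> {0..T}"
  shows "norm (trajectory t - node (step t)) \<le> growth T * \<tau>"
proof -
  have b: "step t * \<tau> \<le> t" "t < (real (step t) + 1) * \<tau>" using step_bounds[of t] assms by auto
  have "trajectory (step t * \<tau>) = node (step t)"
    using trajectory_eq[of "step t" "step t * \<tau>"] \<tau>_pos by (simp add: algebra_simps)
  then have "norm (trajectory t - node (step t)) \<le> growth T * (t - step t * \<tau>)"
    using trajectory_Lipschitz[of "step t * \<tau>" t T] b assms \<tau>_pos by simp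
  also have "\<dots> \<le> growth T * \<tau>"
    using b growth_nonneg by (intro mult_left_mono) (auto simp: algebra_simps)
  finally show ?thesis .
qed

lemma step_right_constant:
  assumes "0 \<le> t"
  shows "\<forall>\<^sub>F s in at_right t. step s = step t"
proof (rule eventually_at_rightI)
  show "t < (real (step t) + 1) * \<tau>" by (rule step_bounds(2)[OF assms])
  fix s assume "s \<in> {t<..<(real (step t) + 1) * \<tau>}"
  then show "step s = step t" using step_bounds(1)[OF assms] by (intro step_eq) auto
qed

lemma step_le: "0 \<le> t \<Longrightarrow> t \<le> T \<Longrightarrow> step t \<le> step T"
  unfolding step_def using \<tau>_pos by (intro nat_mono floor_mono divide_right_mono) auto

end

section \<open>The monotone nonlinearity and its truncations\<close>

locale positive_operator =
  fixes B :: "'a::real_inner \<Rightarrow> 'a"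
  assumes bounded: "bounded_linear B" and selfadjoint: "selfadjoint_op B" and positive: "positive_op B"
begin

text \<open>The norm of the square root of \<open>B\<close> applied to \<open>x\<close>, expressed
  without forming that root; \<open>sqrt_onorm\<close> plays the part of its operator norm.\<close>

definition seminorm :: "'a \<Rightarrow> real" where "seminorm x = sqrt (B x \<bullet> x)"

definition sqrt_onorm :: real where "sqrt_onorm = sqrt (onorm B)"

lemma linear_B: "linear B"
  by (rule bounded_linear.linear[OF bounded])

lemma form_nonneg: "0 \<le> B x \<bullet> x"
  using positive by (simp add: positive_op_def)

lemma form_commute: "B x \<bullet> y = B y \<bullet> x"
  using selfadjoint by (simp add: selfadjoint_op_def inner_commute)

lemma seminorm_nonneg [simp]: "0 \<le> seminorm x"
  by (simp add: seminorm_def form_nonneg)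

lemma seminorm_square: "(seminorm x)\<^sup>2 = B x \<bullet> x"
  by (simp add: seminorm_def form_nonneg)

lemma sqrt_onorm_nonneg [simp]: "0 \<le> sqrt_onorm" and sqrt_onorm_square: "sqrt_onorm * sqrt_onorm = onorm B"
  using onorm_pos_le[OF bounded] by (simp_all add: sqrt_onorm_def)

text \<open>The form at \<open>x + t *\<^sub>R y\<close> is a nonnegative polynomial in
  \<open>t\<close>, evaluated at its minimiser when the leading coefficient is positive.\<close>

lemma form_Cauchy_Schwarz: "(B x \<bullet> y)\<^sup>2 \<le> (B x \<bullet> x) * (B y \<bullet> y)"
proof -
  have expand: "0 \<le> B x \<bullet> x + 2 * t * (B x \<bullet> y) + t\<^sup>2 * (B y \<bullet> y)" for t
    using form_nonneg[of "x + t *\<^sub>R y"] form_commute[of y x]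
    by (simp add: linear_add[OF linear_B] linear_scale[OF linear_B] inner_add_left inner_add_right
        power2_eq_square algebra_simps)
  show ?thesis
  proof (cases "B y \<bullet> y = 0")
    case True
    have "B x \<bullet> y = 0"
    proof (rule ccontr)
      assume "B x \<bullet> y \<noteq> 0"
      \<comment> \<open>Without a quadratic term the polynomial is affine, and this parameter gives
        it the value \<open>-1\<close>.\<close>
      then show False
        using expand[of "- (B x \<bullet> x + 1) / (2 * (B x \<bullet> y))"] True by (simp add: field_simps)
    qed
    then show ?thesis using True by simp
  next
    case False
    then have pos: "0 < B y \<bullet> y" using form_nonneg[of y] by simp
    show ?thesis
      using expand[of "- (B x \<bullet> y) / (B y \<bullet> y)"] pos
      by (simp add: power2_eq_square field_simps)
  qed
qed

lemma abs_form_le: "\<bar>B x \<bullet> y\<bar> \<le> seminorm x * seminorm y"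
proof (rule power2_le_imp_le)
  show "\<bar>B x \<bullet> y\<bar>\<^sup>2 \<le> (seminorm x * seminorm y)\<^sup>2"
    using form_Cauchy_Schwarz by (simp add: power_mult_distrib seminorm_square)
qed simp

lemma seminorm_le: "seminorm x \<le> sqrt_onorm * norm x"
proof (rule power2_le_imp_le)
  have "B x \<bullet> x \<le> norm (B x) * norm x" by (rule norm_cauchy_schwarz)
  also have "\<dots> \<le> onorm B * norm x * norm x"
    by (intro mult_right_mono onorm[OF bounded]) simp
  finally show "(seminorm x)\<^sup>2 \<le> (sqrt_onorm * norm x)\<^sup>2"
    by (simp add: seminorm_square power_mult_distrib power2_eq_square[of "norm x"] power2_eq_square[of sqrt_onorm] sqrt_onorm_square mult_ac)
qed simp

text \<open>Cauchy-Schwarz for the form, applied to \<open>x\<close> and \<open>B x\<close>, after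
  which one factor \<open>norm (B x)\<close> cancels.\<close>

lemma norm_B_le: "norm (B x) \<le> sqrt_onorm * seminorm x"
proof (cases "B x = 0")
  case False
  have "norm (B x) * norm (B x) = B x \<bullet> B x" by (simp add: dot_square_norm power2_eq_square)
  also have "\<dots> \<le> seminorm x * seminorm (B x)" using abs_form_le[of x "B x"] by simp
  also have "\<dots> \<le> seminorm x * (sqrt_onorm * norm (B x))" by (intro mult_left_mono seminorm_le) simp
  finally have "norm (B x) * norm (B x) \<le> (sqrt_onorm * seminorm x) * norm (B x)" by (simp add: mult_ac)
  then show ?thesis using False by simp
qed simp

lemma seminorm_diff_le: "seminorm x - seminorm y \<le> seminorm (x - y)"
proof -
  have "(seminorm x)\<^sup>2 = (seminorm (x - y))\<^sup>2 + 2 * (B (x - y) \<bullet> y) + (seminorm y)\<^sup>2"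
    using form_commute[of x y]
    by (simp add: seminorm_square linear_diff[OF linear_B] inner_diff_left inner_diff_right)
  also have "\<dots> \<le> (seminorm (x - y))\<^sup>2 + 2 * (seminorm (x - y) * seminorm y) + (seminorm y)\<^sup>2"
    using abs_form_le[of "x - y" y] by simp
  also have "\<dots> = (seminorm (x - y) + seminorm y)\<^sup>2" by (simp add: power2_sum)
  finally have "seminorm x \<le> seminorm (x - y) + seminorm y" by (rule power2_le_imp_le) simp
  then show ?thesis by simp
qed

text \<open>Common shape of the power feedback and its truncations, so that their properties reduce
  to those of a scalar profile \<open>a\<close>.\<close>

definition radial :: "(real \<Rightarrow> real) \<Rightarrow> 'a \<Rightarrow> 'a" where
  "radial a x = a (seminorm x) *\<^sub>R B x"

text \<open>Cauchy-Schwarz for the form bounds the mixed term from above and leaves the scalar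
  inequality that expresses monotonicity of s a(s).\<close>

lemma radial_monotone:
  assumes nonneg: "\<And>s. 0 \<le> s \<Longrightarrow> 0 \<le> a s"
    and mono: "\<And>s t. 0 \<le> s \<Longrightarrow> s \<le> t \<Longrightarrow> s * a s \<le> t * a t"
  shows "0 \<le> (radial a x - radial a y) \<bullet> (x - y)"
proof -
  have "0 \<le> (a (seminorm x) * seminorm x - a (seminorm y) * seminorm y) * (seminorm x - seminorm y)"
    using mono[of "seminorm x" "seminorm y"] mono[of "seminorm y" "seminorm x"]
    by (cases "seminorm x \<le> seminorm y") (auto simp: mult_ac intro: mult_nonpos_nonpos mult_nonneg_nonneg)
  also have "\<dots> = a (seminorm x) * (seminorm x)\<^sup>2 + a (seminorm y) * (seminorm y)\<^sup>2 - (a (seminorm x) + a (seminorm y)) * (seminorm x * seminorm y)"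
    by (simp add: power2_eq_square algebra_simps)
  also have "\<dots> \<le> a (seminorm x) * (B x \<bullet> x) + a (seminorm y) * (B y \<bullet> y) - (a (seminorm x) + a (seminorm y)) * (B x \<bullet> y)"
    unfolding seminorm_square using abs_form_le[of x y] nonneg
    by (intro diff_mono order_refl mult_left_mono) (auto simp: add_nonneg_nonneg)
  also have "\<dots> = (radial a x - radial a y) \<bullet> (x - y)"
    using form_commute[of x y]
    by (simp add: radial_def inner_diff_left inner_diff_right algebra_simps)
  finally show ?thesis .
qed

text \<open>For \<open>seminorm y \<le> seminorm x\<close>, the difference splits into
  \<open>B (x - y)\<close> with a bounded coefficient and a multiple of \<open>B y\<close>.
  Monotonicity of s a(s) trades the change of \<open>a\<close> in the latter for the change of the
  seminorm, so each part contributes the same bound.\<close>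

lemma radial_Lipschitz:
  assumes nonneg: "\<And>s. 0 \<le> s \<Longrightarrow> 0 \<le> a s"
    and mono: "\<And>s t. 0 \<le> s \<Longrightarrow> s \<le> t \<Longrightarrow> s * a s \<le> t * a t"
    and anti: "\<And>s t. 0 \<le> s \<Longrightarrow> s \<le> t \<Longrightarrow> a t \<le> a s"
    and bound: "\<And>s. 0 \<le> s \<Longrightarrow> a s \<le> M"
  shows "norm (radial a x - radial a y) \<le> 2 * M * sqrt_onorm\<^sup>2 * norm (x - y)"
proof -
  have *: "norm (radial a x - radial a y) \<le> 2 * M * sqrt_onorm\<^sup>2 * norm (x - y)" if le: "seminorm y \<le> seminorm x" for x y
  proof -
    have M: "0 \<le> M" using nonneg[of 0] bound[of 0] by simp
    have "radial a x - radial a y = a (seminorm x) *\<^sub>R B (x - y) - (a (seminorm y) - a (seminorm x)) *\<^sub>R B y"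
      by (simp add: radial_def linear_diff[OF linear_B] algebra_simps)
    then have "norm (radial a x - radial a y) \<le> a (seminorm x) * norm (B (x - y)) + (a (seminorm y) - a (seminorm x)) * norm (B y)"
      using norm_triangle_ineq4[of "a (seminorm x) *\<^sub>R B (x - y)" "(a (seminorm y) - a (seminorm x)) *\<^sub>R B y"]
        nonneg[of "seminorm x"] anti[OF _ le] by simp
    also have "\<dots> \<le> M * (sqrt_onorm * seminorm (x - y)) + (a (seminorm y) - a (seminorm x)) * (sqrt_onorm * seminorm y)"
      using nonneg[of "seminorm x"] anti[OF _ le] bound[of "seminorm x"] M
      by (intro add_mono mult_mono norm_B_le) auto
    also have "(a (seminorm y) - a (seminorm x)) * (sqrt_onorm * seminorm y) \<le> M * (sqrt_onorm * seminorm (x - y))"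
    proof -
      have "(a (seminorm y) - a (seminorm x)) * seminorm y \<le> a (seminorm x) * (seminorm x - seminorm y)"
        using mono[OF _ le] by (simp add: algebra_simps)
      also have "\<dots> \<le> M * seminorm (x - y)"
        using bound[of "seminorm x"] seminorm_diff_le[of x y] le M by (intro mult_mono) auto
      finally show ?thesis
        using mult_left_mono[of _ _ sqrt_onorm, OF _ sqrt_onorm_nonneg] by (fastforce simp: mult_ac)
    qed
    also have "M * (sqrt_onorm * seminorm (x - y)) + M * (sqrt_onorm * seminorm (x - y)) \<le> M * (sqrt_onorm * (sqrt_onorm * norm (x - y))) + M * (sqrt_onorm * (sqrt_onorm * norm (x - y)))"
      using M by (intro add_mono mult_left_mono seminorm_le) auto
    finally show ?thesis by (simp add: power2_eq_square mult_ac)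
  qed
  show ?thesis
    using *[of x y] *[of y x] by (cases "seminorm y \<le> seminorm x") (auto simp: norm_minus_commute)
qed

end

text \<open>For \<open>\<epsilon> = 0\<close> and \<open>s \<ge> 0\<close> this is the untruncated
  power; at \<open>s = 0\<close> its value is \<open>0\<close>, since
  \<open>0 powr - \<beta> = 0\<close>.\<close>

definition cutoff_power :: "real \<Rightarrow> real \<Rightarrow> real \<Rightarrow> real" where
  "cutoff_power \<beta> \<epsilon> s = max s \<epsilon> powr - \<beta>"

lemma mult_powr_minus: "0 \<le> s \<Longrightarrow> s * s powr - \<beta> = s powr (1 - \<beta>)" for s :: real
  by (cases "s = 0") (auto simp: powr_diff powr_minus field_simps)

text \<open>The product is linear in \<open>s\<close> up to \<open>\<epsilon>\<close> and the
  increasing power \<open>s powr (1 - \<beta>)\<close> beyond; the two meet at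
  \<open>\<epsilon>\<close>.\<close>

lemma mult_cutoff_power_mono:
  assumes "\<beta> < 1" "0 \<le> \<epsilon>" "0 \<le> s" "s \<le> t"
  shows "s * cutoff_power \<beta> \<epsilon> s \<le> t * cutoff_power \<beta> \<epsilon> t"
proof -
  consider "t \<le> \<epsilon>" | "\<epsilon> \<le> s" | "s < \<epsilon>" "\<epsilon> < t" by linarith
  then show ?thesis
  proof cases
    case 1
    then show ?thesis using assms by (simp add: cutoff_power_def max_def mult_right_mono)
  next
    case 2
    then show ?thesis
      using assms by (simp add: cutoff_power_def max_absorb1 mult_powr_minus powr_mono2)
  next
    case 3
    have "s * \<epsilon> powr - \<beta> \<le> \<epsilon> * \<epsilon> powr - \<beta>" using 3 by (intro mult_right_mono) auto
    also have "\<dots> \<le> t * t powr - \<beta>" using 3 assms by (simp add: mult_powr_minus powr_mono2)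
    finally show ?thesis using 3 by (simp add: cutoff_power_def max_def)
  qed
qed

lemma cutoff_power_antimono:
  assumes "0 \<le> \<beta>" "0 < \<epsilon>" "s \<le> t"
  shows "cutoff_power \<beta> \<epsilon> t \<le> cutoff_power \<beta> \<epsilon> s"
  unfolding cutoff_power_def using assms by (intro powr_mono2') auto

lemma cutoff_power_le:
  assumes "0 \<le> \<beta>" "0 < \<epsilon>"
  shows "cutoff_power \<beta> \<epsilon> s \<le> \<epsilon> powr - \<beta>"
  unfolding cutoff_power_def using assms by (intro powr_mono2') auto

text \<open>The factor \<open>s\<close> tames the singularity: below \<open>\<epsilon>\<close> both
  products lie between \<open>0\<close> and \<open>\<epsilon> powr (1 - \<beta>)\<close>, and from
  \<open>\<epsilon>\<close> on they coincide.\<close>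

lemma mult_cutoff_power_close:
  assumes "\<beta> < 1" "0 < \<epsilon>" "0 \<le> s"
  shows "s * \<bar>cutoff_power \<beta> 0 s - cutoff_power \<beta> \<epsilon> s\<bar> \<le> \<epsilon> powr (1 - \<beta>)"
proof (cases "s < \<epsilon>")
  case True
  have eq: "s * \<bar>cutoff_power \<beta> 0 s - cutoff_power \<beta> \<epsilon> s\<bar> = \<bar>s powr (1 - \<beta>) - s * \<epsilon> powr - \<beta>\<bar>"
    using assms True mult_powr_minus[of s \<beta>]
    by (simp add: cutoff_power_def max_def abs_mult_pos' right_diff_distrib)
  have "s powr (1 - \<beta>) \<le> \<epsilon> powr (1 - \<beta>)" using assms True by (simp add: powr_mono2)
  moreover have "s * \<epsilon> powr - \<beta> \<le> \<epsilon> powr (1 - \<beta>)"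
    using mult_right_mono[of s \<epsilon> "\<epsilon> powr - \<beta>"] assms True mult_powr_minus[of \<epsilon> \<beta>] by simp
  moreover have "0 \<le> s powr (1 - \<beta>)" "0 \<le> s * \<epsilon> powr - \<beta>" using assms by auto
  ultimately show ?thesis unfolding eq by linarith
qed (use assms in \<open>auto simp: cutoff_power_def max_def\<close>)

context positive_operator
begin

lemma radial_cutoff_close:
  assumes "\<beta> < 1" "0 < \<epsilon>"
  shows "norm (radial (cutoff_power \<beta> 0) x - radial (cutoff_power \<beta> \<epsilon>) x) \<le> sqrt_onorm * \<epsilon> powr (1 - \<beta>)"
proof -
  let ?\<delta> = "\<bar>cutoff_power \<beta> 0 (seminorm x) - cutoff_power \<beta> \<epsilon> (seminorm x)\<bar>"
  have "norm (radial (cutoff_power \<beta> 0) x - radial (cutoff_power \<beta> \<epsilon>) x) = ?\<delta> * norm (B x)"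
    by (simp add: radial_def scaleR_diff_left[symmetric])
  also have "\<dots> \<le> ?\<delta> * (sqrt_onorm * seminorm x)" by (intro mult_left_mono norm_B_le) simp
  also have "\<dots> = sqrt_onorm * (seminorm x * ?\<delta>)" by (simp add: mult_ac)
  also have "\<dots> \<le> sqrt_onorm * \<epsilon> powr (1 - \<beta>)"
    using assms by (intro mult_left_mono mult_cutoff_power_close) auto
  finally show ?thesis .
qed

lemma radial_cutoff_Lipschitz:
  assumes "0 \<le> \<beta>" "\<beta> < 1" "0 < \<epsilon>"
  shows "norm (radial (cutoff_power \<beta> \<epsilon>) x - radial (cutoff_power \<beta> \<epsilon>) y)
    \<le> 2 * \<epsilon> powr - \<beta> * sqrt_onorm\<^sup>2 * norm (x - y)"
  using assms
  by (intro radial_Lipschitz mult_cutoff_power_mono cutoff_power_antimono cutoff_power_le)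
     (auto simp: cutoff_power_def)

lemma radial_power_monotone:
  assumes "\<beta> < 1"
  shows "0 \<le> (radial (cutoff_power \<beta> 0) x - radial (cutoff_power \<beta> 0) y) \<bullet> (x - y)"
  using assms by (intro radial_monotone mult_cutoff_power_mono) (auto simp: cutoff_power_def)

text \<open>The seminorm is the square root of the form, which halves the exponent.\<close>

lemma radial_power_eq:
  "radial (cutoff_power (2 * \<mu>) 0) x = (B x \<bullet> x) powr - \<mu> *\<^sub>R B x"
  using form_nonneg[of x]
  by (simp add: radial_def cutoff_power_def seminorm_def powr_half_sqrt[symmetric] powr_powr)

end

section \<open>Weak solutions\<close>

lemma L1_norm_le:
  fixes f :: "real \<Rightarrow> 'a::real_normed_vector"
  assumes "0 \<le> T" "\<And>t. 0 < t \<Longrightarrow> t < T \<Longrightarrow> norm (f t) \<le> C"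
  shows "L1_norm T f \<le> ennreal (C * T)"
proof (cases "T = 0")
  case False
  then have "0 \<le> C" using assms(1) order_trans[OF norm_ge_zero assms(2)[of "T / 2"]] by simp
  have "L1_norm T f \<le> (\<integral>\<^sup>+t. ennreal C \<partial>lebesgue_on {0<..<T})"
    unfolding L1_norm_def
    by (intro nn_integral_mono ennreal_leI assms(2)) (auto simp: space_restrict_space)
  also have "\<dots> = ennreal (C * T)"
    using assms(1) \<open>0 \<le> C\<close> by (simp add: emeasure_restrict_space space_restrict_space ennreal_mult)
  finally show ?thesis .
qed (simp add: L1_norm_def space_restrict_space nn_integral_empty)

text \<open>Sampling on grids of mesh \<open>1 / Suc i\<close> produces simple functions, and right
  continuity makes the samples converge at every point; the bound gives finiteness of the
  norm.\<close>

lemma L1_fun_right_continuous: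
  fixes f :: "real \<Rightarrow> 'a::real_normed_vector"
  assumes "0 \<le> T" and bound: "\<And>t. 0 < t \<Longrightarrow> t < T \<Longrightarrow> norm (f t) \<le> C"
    and right: "\<And>t. 0 < t \<Longrightarrow> t < T \<Longrightarrow> (f \<longlongrightarrow> f t) (at_right t)"
  shows "L1_fun T f"
proof -
  let ?M = "lebesgue_on {0<..<T}"
  \<comment> \<open>Adding \<open>1\<close> to the floor puts the sample point strictly to the right
    of \<open>t\<close>, as the filter \<open>at_right t\<close> demands.\<close>
  define r where "r i t = (real_of_int \<lfloor>real (Suc i) * t\<rfloor> + 1) / real (Suc i)" for i t
  have "simple_function ?M (\<lambda>t. f (r i t))" for i
  proof -
    have "simple_function ?M (\<lambda>t. \<lfloor>real (Suc i) * t\<rfloor>)"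
      unfolding simple_function_def
    proof (intro conjI ballI)
      have "(\<lambda>t. \<lfloor>real (Suc i) * t\<rfloor>) ` space ?M \<subseteq> {0..\<lfloor>real (Suc i) * T\<rfloor>}"
        by (auto simp: space_restrict_space intro!: floor_mono mult_left_mono)
      then show "finite ((\<lambda>t. \<lfloor>real (Suc i) * t\<rfloor>) ` space ?M)"
        by (rule finite_subset) simp
      have "(\<lambda>t::real. \<lfloor>real (Suc i) * t\<rfloor>) \<in> borel \<rightarrow>\<^sub>M count_space UNIV"
        by measurable
      then have "(\<lambda>t. \<lfloor>real (Suc i) * t\<rfloor>) \<in> ?M \<rightarrow>\<^sub>M count_space UNIV"
        by (intro measurable_restrict_space1 measurable_completion) simp
      then show "(\<lambda>t. \<lfloor>real (Suc i) * t\<rfloor>) -` {k} \<inter> space ?M \<in> sets ?M" for k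
        by (rule measurable_sets) simp
    qed
    then show ?thesis
      unfolding r_def by (rule simple_function_compose1[where g = "\<lambda>k. f ((real_of_int k + 1) / real (Suc i))"])
  qed
  moreover have "(\<lambda>i. f (r i t)) \<longlonglongrightarrow> f t" if t: "0 < t" "t < T" for t
  proof -
    have gt: "t < r i t" for i
      using floor_correct[of "real (Suc i) * t"] by (simp add: r_def pos_less_divide_eq mult.commute)
    have le: "r i t \<le> t + inverse (real (Suc i))" for i
    proof -
      have "r i t \<le> (real (Suc i) * t + 1) / real (Suc i)"
        unfolding r_def by (intro divide_right_mono add_right_mono of_int_floor_le) simp
      also have "\<dots> = t + inverse (real (Suc i))" by (simp add: field_simps)
      finally show ?thesis .
    qed
    have upper: "(\<lambda>i. t + inverse (real (Suc i))) \<longlonglongrightarrow> t"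
      using tendsto_add[OF tendsto_const LIMSEQ_inverse_real_of_nat, of t] by simp
    have "(\<lambda>i. r i t) \<longlonglongrightarrow> t"
      by (rule tendsto_sandwich[OF always_eventually always_eventually tendsto_const upper])
         (simp_all add: less_imp_le[OF gt] le del: of_nat_Suc)
    then have "filterlim (\<lambda>i. r i t) (at_right t) sequentially"
      by (rule tendsto_imp_filterlim_at_right) (simp add: gt)
    then show ?thesis by (rule filterlim_compose[OF right[OF t]])
  qed
  moreover have "L1_norm T f < \<infinity>"
    using le_less_trans[OF L1_norm_le[OF assms(1) bound] ennreal_less_top] by simp
  ultimately show ?thesis
    unfolding L1_fun_def
    by (intro conjI exI[of _ "\<lambda>i t. f (r i t)"] allI iffD2[OF AE_restrict_space_iff] always_eventually) auto
qed

context semilinear_scheme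
begin

text \<open>The forcing is the defect made by replacing \<open>G0\<close> at the current point with
  \<open>G\<close> at the last node; adding it to the equation with \<open>F\<close> recovers the
  derivative of the trajectory off the grid.\<close>

lemma strong_solution_trajectory:
  assumes eq: "\<And>x. x \<in> D \<Longrightarrow> F x = G0 x" and cont: "continuous_on UNIV G0" and T: "0 < T"
  shows "strong_solution D A F (\<lambda>t. G0 (trajectory t) - G (node (step t))) T trajectory"
  unfolding strong_solution_def
proof (intro conjI allI impI)
  have cont_G0: "continuous_on {0..T} (\<lambda>t. G0 (trajectory t))" for T
    by (rule continuous_on_compose2[OF cont continuous_on_path]) simp
  have "bounded ((\<lambda>t. G0 (trajectory t)) ` {0..T})"
    by (rule compact_imp_bounded[OF compact_continuous_image[OF cont_G0 compact_Icc]])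
  then obtain C1 where C1: "\<And>t. t \<in> {0..T} \<Longrightarrow> norm (G0 (trajectory t)) \<le> C1"
    unfolding bounded_iff by blast
  show "L1_fun T (\<lambda>t. G0 (trajectory t) - G (node (step t)))"
  proof (rule L1_fun_right_continuous)
    fix t :: real assume t: "0 < t" "t < T"
    \<comment> \<open>Only finitely many nodes are visited before \<open>T\<close>, so a crude bound
      suffices for integrability; smallness is a separate matter.\<close>
    have "norm (G (node (step t))) \<le> (\<Sum>k\<le>step T. norm (G (node k)))"
      using t step_le[of t T] by (intro member_le_sum) auto
    then show "norm (G0 (trajectory t) - G (node (step t))) \<le> C1 + (\<Sum>k\<le>step T. norm (G (node k)))"
      using C1[of t] t by (intro order_trans[OF norm_triangle_ineq4] add_mono) auto
    have "isCont (\<lambda>t. G0 (trajectory t)) t"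
      using cont_G0[of "t + 1"] t by (intro continuous_on_interior[of "{0..t + 1}"]) auto
    then have "((\<lambda>t. G0 (trajectory t)) \<longlongrightarrow> G0 (trajectory t)) (at_right t)"
      by (simp add: isCont_def filterlim_at_split)
    moreover have "((\<lambda>s. G (node (step s))) \<longlongrightarrow> G (node (step t))) (at_right t)"
      using step_right_constant[of t] t by (intro tendsto_eventually) (auto elim: eventually_mono)
    ultimately show "((\<lambda>t. G0 (trajectory t) - G (node (step t))) \<longlongrightarrow> G0 (trajectory t) - G (node (step t))) (at_right t)"
      by (rule tendsto_diff)
  qed (use T in simp)
  show "continuous_on {0..T} trajectory" by (rule continuous_on_path)
  show "abs_continuous_on K trajectory" if "compact K" "K \<subseteq> {0<..<T}" for K
  proof (rule lipschitz_imp_abs_continuous_on)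
    fix a b assume "a \<in> K" "b \<in> K" "a \<le> b"
    then have "0 \<le> a" "b \<le> T" using that(2) by (force simp: subset_iff)+
    then show "norm (trajectory b - trajectory a) \<le> growth T * (b - a)"
      using \<open>a \<le> b\<close> by (intro trajectory_Lipschitz)
  qed
  have "AE t in lebesgue. t \<notin> range (\<lambda>k::nat. k * \<tau>)"
    by (intro AE_not_in null_sets_completionI countable_imp_null_set_lborel countable_image) simp
  then have "AE t in lebesgue. t \<in> {0<..<T} \<longrightarrow> trajectory t \<in> D \<and>
      (trajectory has_vector_derivative A (trajectory t) - F (trajectory t) + (G0 (trajectory t) - G (node (step t)))) (at t)"
  proof eventually_elim
    case (elim t)
    then show ?case
      using trajectory_domain(1)[of t] trajectory_derivative[of t] eq by auto
  qed
  then show "AE t in lebesgue_on {0<..<T}. trajectory t \<in> D \<and>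
      (trajectory has_vector_derivative A (trajectory t) - F (trajectory t) + (G0 (trajectory t) - G (node (step t)))) (at t)"
    by (rule iffD2[OF AE_restrict_space_iff, rotated]) simp
qed

end

section \<open>Approximation, uniqueness and existence of weak solutions\<close>

context quasi_contractive_semigroup
begin

text \<open>One \<open>\<eta>\<close> pays for replacing \<open>G0\<close> by \<open>G\<close>, the
  other for freezing \<open>G\<close>. The same path is a strong solution on every interval, while
  its forcing is controlled up to \<open>N\<close>.\<close>

lemma strong_approximation:
  assumes eq: "\<And>x. x \<in> D \<Longrightarrow> F x = G0 x" and cont: "continuous_on UNIV G0"
    and Lip: "\<And>u v. norm (G u - G v) \<le> L * norm (u - v)" "0 \<le> L"
    and close: "\<And>x. norm (G0 x - G x) \<le> \<eta>" and \<eta>: "0 < \<eta>" and x0: "x0 \<in> D"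
  obtains y f where "y 0 = x0" "\<And>T. 0 < T \<Longrightarrow> strong_solution D A F f T y"
    "\<And>t. t \<in> {0..N} \<Longrightarrow> norm (f t) \<le> 2 * \<eta>"
proof -
  \<comment> \<open>The Lipschitz constant \<open>growth N\<close> with \<open>\<tau>\<close>
    replaced by \<open>1\<close>: it dominates for every \<open>\<tau> \<le> 1\<close>, so
    \<open>\<tau>\<close> can be chosen afterwards.\<close>
  define g where "g = exp \<omega> * (exp ((\<omega> + L) * N) * norm (A x0 - G x0))"
  have g: "0 \<le> g" by (simp add: g_def)
  \<comment> \<open>Makes the freezing error \<open>L * g * \<tau>\<close> at most
    \<open>\<eta>\<close>; the added \<open>1\<close> keeps the denominator positive.\<close>
  define \<tau> where "\<tau> = min 1 (\<eta> / (L * g + 1))"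
  have \<tau>: "0 < \<tau>" "\<tau> \<le> 1" using \<eta> g Lip(2) by (auto simp: \<tau>_def add_nonneg_pos)
  interpret semilinear_scheme D A S \<omega> G L \<tau> x0
    using Lip \<tau> x0 by unfold_locales auto
  show ?thesis
  proof (rule that[of trajectory "\<lambda>t. G0 (trajectory t) - G (node (step t))"])
    show "trajectory 0 = x0" by (rule trajectory_0)
    show "strong_solution D A F (\<lambda>t. G0 (trajectory t) - G (node (step t))) T trajectory" if "0 < T" for T
      using eq cont that by (rule strong_solution_trajectory)
    fix t assume t: "t \<in> {0..N}"
    have "growth N \<le> g"
      unfolding growth_def g_def velocity_def node.simps using \<tau> \<omega>_nonneg
      by (intro mult_right_mono) (auto simp: mult_left_le)
    have "norm (G (trajectory t) - G (node (step t))) \<le> L * (growth N * \<tau>)"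
      using trajectory_node_close[OF t] Lip by (meson mult_left_mono order_trans)
    also have "\<dots> \<le> L * (g * \<tau>)"
      using \<open>growth N \<le> g\<close> Lip(2) \<tau> by (intro mult_left_mono mult_right_mono) auto
    also have "\<dots> \<le> (L * g + 1) * (\<eta> / (L * g + 1))"
      using \<tau> Lip(2) g unfolding mult.assoc[symmetric] by (intro mult_mono) (auto simp: \<tau>_def)
    also have "\<dots> = \<eta>"
      using Lip(2) g by (simp add: add_nonneg_eq_0_iff)
    finally have "norm ((G0 (trajectory t) - G (trajectory t)) + (G (trajectory t) - G (node (step t)))) \<le> \<eta> + \<eta>"
      using close by (intro norm_triangle_le add_mono)
    then show "norm (G0 (trajectory t) - G (node (step t))) \<le> 2 * \<eta>" by simp
  qed
qed

text \<open>Passes to the limit in the distance estimate for the approximating strong solutions; the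
  initial distance and both forcing norms vanish in the limit.\<close>

lemma weak_solution_unique:
  fixes F :: "'a \<Rightarrow> 'a"
  assumes diss: "\<And>x z. x \<in> D \<Longrightarrow> z \<in> D \<Longrightarrow>
      ((A x - F x) - (A z - F z)) \<bullet> (x - z) \<le> K * (norm (x - z))\<^sup>2"
    and K: "0 \<le> K" and T: "0 < T"
    and y: "weak_solution_on D A F y0 T y" and z: "weak_solution_on D A F y0 T z"
    and t: "t \<in> {0..T}"
  shows "z t = y t"
proof -
  obtain f Y where f: "(\<lambda>n. L1_norm T (f n)) \<longlonglongrightarrow> 0"
    and Y: "\<And>n::nat. strong_solution D A F (f n) T (Y n)" "uniform_limit {0..T} Y y sequentially"
    using y by (auto simp: weak_solution_on_def)
  obtain g Z where g: "(\<lambda>n. L1_norm T (g n)) \<longlonglongrightarrow> 0"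
    and Z: "\<And>n::nat. strong_solution D A F (g n) T (Z n)" "uniform_limit {0..T} Z z sequentially"
    using z by (auto simp: weak_solution_on_def)
  have init: "y 0 = y0" "z 0 = y0" using y z by (auto simp: weak_solution_on_def)
  have lim: "(\<lambda>n. Y n s) \<longlonglongrightarrow> y s" "(\<lambda>n. Z n s) \<longlonglongrightarrow> z s" if "s \<in> {0..T}" for s
    using tendsto_uniform_limitI[OF Y(2) that] tendsto_uniform_limitI[OF Z(2) that] .
  have zero: "(\<lambda>n. enn2real (L1_norm T (f n))) \<longlonglongrightarrow> 0" "(\<lambda>n. enn2real (L1_norm T (g n))) \<longlonglongrightarrow> 0"
    using tendsto_enn2real[where l = 0, unfolded ennreal_0, OF _ order_refl] f g by blast+
  have "(\<lambda>n. 2 * exp (2 * K * T) * (norm (Y n 0 - Z n 0) + enn2real (L1_norm T (f n)) + enn2real (L1_norm T (g n))))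
      \<longlonglongrightarrow> 2 * exp (2 * K * T) * (norm (y 0 - z 0) + 0 + 0)"
    using T by (intro tendsto_intros lim zero) auto
  moreover have "(\<lambda>n. norm (Y n t - Z n t)) \<longlonglongrightarrow> norm (y t - z t)"
    using t by (intro tendsto_intros lim)
  moreover have "norm (Y n t - Z n t) \<le> 2 * exp (2 * K * T) *
      (norm (Y n 0 - Z n 0) + enn2real (L1_norm T (f n)) + enn2real (L1_norm T (g n)))" for n
    by (rule strong_solutions_dist[OF diss K T Y(1) Z(1) t])
  ultimately have "norm (y t - z t) \<le> 2 * exp (2 * K * T) * (norm (y 0 - z 0) + 0 + 0)"
    by (rule tendsto_le[OF sequentially_bot _ _ always_eventually[OF allI]])
  then show ?thesis by (simp add: init)
qed

text \<open>The n-th strong solution starts within \<open>inverse (Suc n)\<close> of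
  \<open>y0\<close> and has forcing of at most that size on \<open>[0, n]\<close>. The distance
  estimate makes the sequence uniformly Cauchy on every bounded interval.\<close>

lemma weak_solution_exists:
  fixes F :: "'a \<Rightarrow> 'a"
  assumes diss: "\<And>x z. x \<in> D \<Longrightarrow> z \<in> D \<Longrightarrow>
      ((A x - F x) - (A z - F z)) \<bullet> (x - z) \<le> K * (norm (x - z))\<^sup>2"
    and K: "0 \<le> K"
    and eq: "\<And>x. x \<in> D \<Longrightarrow> F x = G0 x"
    and approx: "\<And>\<eta>. 0 < \<eta> \<Longrightarrow> \<exists>G L. 0 \<le> L \<and> (\<forall>u v. norm (G u - G v) \<le> L * norm (u - v)) \<and>
      (\<forall>x. norm (G0 x - G x) \<le> \<eta>)"
  obtains y where "continuous_on {0..} y" "weak_solution D A F y0 y"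
proof -
  have cont: "continuous_on UNIV G0"
  proof -
    have "\<forall>n. \<exists>G. continuous_on UNIV G \<and> (\<forall>x. norm (G0 x - G x) \<le> inverse (Suc n))"
    proof
      fix n
      obtain G L where "0 \<le> L" "\<forall>u v. norm (G u - G v) \<le> L * norm (u - v)" "\<forall>x. norm (G0 x - G x) \<le> inverse (Suc n)"
        using approx[of "inverse (Suc n)"] by auto
      then show "\<exists>G. continuous_on UNIV G \<and> (\<forall>x. norm (G0 x - G x) \<le> inverse (Suc n))"
        by (intro exI[of _ G] conjI lipschitz_on_continuous_on[of L] lipschitz_onI) (auto simp: dist_norm)
    qed
    then obtain G where G: "\<And>n. continuous_on UNIV (G n)" "\<And>n x. norm (G0 x - G n x) \<le> inverse (Suc n)"
      by metis
    have "uniform_limit UNIV G G0 sequentially"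
    proof (rule uniform_limitI)
      fix e :: real assume "0 < e"
      then have "\<forall>\<^sub>F n in sequentially. inverse (real (Suc n)) < e"
        using order_tendstoD(2)[OF LIMSEQ_inverse_real_of_nat] by blast
      then show "\<forall>\<^sub>F n in sequentially. \<forall>x\<in>UNIV. dist (G n x) (G0 x) < e"
        by eventually_elim (use G(2) in \<open>auto simp: dist_norm norm_minus_commute intro: le_less_trans\<close>)
    qed
    then show ?thesis
      using G(1) by (intro uniform_limit_theorem[of _ G]) auto
  qed
  have "\<exists>y f. norm (y 0 - y0) \<le> inverse (Suc n) \<and> (\<forall>T>0. strong_solution D A F f T y) \<and>
      (\<forall>t\<in>{0..real n}. norm (f t) \<le> inverse (Suc n))" for n
  proof -
    obtain x0 where x0: "x0 \<in> D" "norm (x0 - y0) < inverse (Suc n)"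
      using domain_dense[of "inverse (Suc n)" y0] by auto
    \<comment> \<open>Half of the tolerance, because the strong approximation doubles it.\<close>
    obtain G L where G: "0 \<le> L" "\<And>u v. norm (G u - G v) \<le> L * norm (u - v)"
      "\<And>x. norm (G0 x - G x) \<le> inverse (Suc n) / 2"
      using approx[of "inverse (Suc n) / 2"] by auto
    obtain y f where "y 0 = x0" "\<And>T. 0 < T \<Longrightarrow> strong_solution D A F f T y"
      "\<And>t. t \<in> {0..real n} \<Longrightarrow> norm (f t) \<le> 2 * (inverse (Suc n) / 2)"
      using strong_approximation[OF eq cont G(2,1,3) _ x0(1), where N = "real n"] by auto
    then show ?thesis using x0(2) by (intro exI[of _ y] exI[of _ f]) auto
  qed
  then obtain Y f where init: "\<And>n. norm (Y n 0 - y0) \<le> inverse (Suc n)"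
    and strong: "\<And>n T. 0 < T \<Longrightarrow> strong_solution D A F (f n) T (Y n)"
    and small: "\<And>n t. t \<in> {0..real n} \<Longrightarrow> norm (f n t) \<le> inverse (Suc n)"
    by metis
  have L1: "L1_norm T (f n) \<le> ennreal (inverse (Suc n) * T)" if "0 < T" "T \<le> real n" for T n
    using that small by (intro L1_norm_le) auto
  have L1_real: "enn2real (L1_norm T (f n)) \<le> inverse (Suc n) * T" if "0 < T" "T \<le> real n" for T n
    using enn2real_mono[OF L1[OF that]] that by simp
  \<comment> \<open>Two initial errors and two forcing norms add up to
    \<open>2 * (1 + T) * inverse (Suc N)\<close>; the remaining factor
    \<open>2 * exp (2 * K * T)\<close> is that of the distance estimate.\<close>
  have dist: "norm (Y m t - Y n t) \<le> 4 * exp (2 * K * T) * (1 + T) * inverse (Suc N)"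
    if "0 < T" "T \<le> real N" "N \<le> m" "N \<le> n" "t \<in> {0..T}" for T N m n t
  proof -
    have inv: "inverse (real (Suc m)) \<le> inverse (real (Suc N))" "inverse (real (Suc n)) \<le> inverse (real (Suc N))"
      using that by (auto intro: le_imp_inverse_le)
    have "norm (Y m t - Y n t) \<le> 2 * exp (2 * K * T) *
        (norm (Y m 0 - Y n 0) + enn2real (L1_norm T (f m)) + enn2real (L1_norm T (f n)))"
      by (rule strong_solutions_dist[OF diss K that(1) strong strong that(5)]) (use that in auto)
    also have "\<dots> \<le> 2 * exp (2 * K * T) *
        ((inverse (Suc N) + inverse (Suc N)) + inverse (Suc N) * T + inverse (Suc N) * T)"
    proof (intro mult_left_mono add_mono)
      have "norm (Y m 0 - Y n 0) \<le> norm (Y m 0 - y0) + norm (Y n 0 - y0)"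
        using norm_triangle_ineq4[of "Y m 0 - y0" "Y n 0 - y0"] by simp
      then show "norm (Y m 0 - Y n 0) \<le> inverse (Suc N) + inverse (Suc N)"
        using init[of m] init[of n] inv by linarith
      have "inverse (Suc m) * T \<le> inverse (Suc N) * T" "inverse (Suc n) * T \<le> inverse (Suc N) * T"
        using inv that by (auto intro: mult_right_mono)
      moreover have "T \<le> real m" "T \<le> real n" using that by linarith+
      ultimately show "enn2real (L1_norm T (f m)) \<le> inverse (Suc N) * T" "enn2real (L1_norm T (f n)) \<le> inverse (Suc N) * T"
        using L1_real[of T m] L1_real[of T n] that(1) by linarith+
    qed simp
    finally show ?thesis by (simp add: algebra_simps)
  qed
  \<comment> \<open>A pointwise limit, so that one function serves all intervals.\<close>
  define y where "y t = lim (\<lambda>n. Y n t)" for t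
  have lim: "uniform_limit {0..T} Y y sequentially" if "0 < T" for T
  proof -
    have "uniformly_Cauchy_on {0..T} Y"
    proof (rule uniformly_Cauchy_onI)
      fix e :: real assume "0 < e"
      have "(\<lambda>N. 4 * exp (2 * K * T) * (1 + T) * inverse (real (Suc N))) \<longlonglongrightarrow> 4 * exp (2 * K * T) * (1 + T) * 0"
        by (intro tendsto_intros LIMSEQ_inverse_real_of_nat)
      then have "\<forall>\<^sub>F N in sequentially. 4 * exp (2 * K * T) * (1 + T) * inverse (real (Suc N)) < e"
        using \<open>0 < e\<close> by (intro order_tendstoD(2)[where y = "4 * exp (2 * K * T) * (1 + T) * 0"]) auto
      moreover have "\<forall>\<^sub>F N in sequentially. T \<le> real N"
        using filterlim_real_sequentially by (simp add: filterlim_at_top)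
      ultimately have "\<forall>\<^sub>F N in sequentially. 4 * exp (2 * K * T) * (1 + T) * inverse (real (Suc N)) < e \<and> T \<le> real N"
        by (rule eventually_conj)
      then obtain N where "4 * exp (2 * K * T) * (1 + T) * inverse (real (Suc N)) < e" "T \<le> real N"
        using eventually_happens'[OF sequentially_bot] by blast
      then show "\<exists>M. \<forall>x\<in>{0..T}. \<forall>m\<ge>M. \<forall>n\<ge>M. dist (Y m x) (Y n x) < e"
        unfolding dist_norm using le_less_trans[OF dist[OF that]] by blast
    qed
    then show ?thesis
      unfolding y_def using Cauchy_uniformly_convergent uniformly_convergent_uniform_limit_iff by blast
  qed
  have cont_y: "continuous_on {0..T} y" if "0 < T" for T
    by (rule uniform_limit_theorem[OF _ lim[OF that]])
       (use strong[OF that] in \<open>auto simp: strong_solution_def\<close>)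
  have "y 0 = y0"
  proof (rule LIMSEQ_unique)
    show "(\<lambda>n. Y n 0) \<longlonglongrightarrow> y 0" by (rule tendsto_uniform_limitI[OF lim[of 1]]) auto
    show "(\<lambda>n. Y n 0) \<longlonglongrightarrow> y0"
      using init by (intro LIM_zero_cancel[OF Lim_null_comparison[OF _ LIMSEQ_inverse_real_of_nat]]) simp
  qed
  show ?thesis
  proof (rule that)
    show "continuous_on {0..} y"
      unfolding continuous_on_eq_continuous_within
    proof
      fix t :: real assume "t \<in> {0..}"
      then have "continuous (at t within {0..t + 1}) y"
        using cont_y[of "t + 1"] by (auto simp: continuous_on_eq_continuous_within)
      moreover have "at t within {0..t + 1} = at t within {0..}"
        by (rule at_within_nhd[of _ "{..<t + 1}"]) (use \<open>t \<in> {0..}\<close> in auto)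
      ultimately show "continuous (at t within {0..}) y" by (simp add: continuous_within)
    qed
    show "weak_solution D A F y0 y"
      unfolding weak_solution_def weak_solution_on_def
    proof (intro allI impI conjI)
      fix T :: real assume T: "0 < T"
      show "continuous_on {0..T} y" using T by (rule cont_y)
      \<comment> \<open>The forcing \<open>f n\<close> is known to be small on \<open>[0, T]\<close>
        once \<open>n \<ge> T\<close>; shifting by \<open>m\<close> discards the earlier
        terms.\<close>
      obtain m :: nat where m: "T \<le> real m" using real_arch_simple by blast
      have "(\<lambda>n. L1_norm T (f (n + m))) \<longlonglongrightarrow> 0"
      proof (rule tendsto_sandwich[where f = "\<lambda>_. 0" and h = "\<lambda>n. ennreal (inverse (real (Suc (n + m))) * T)"])
        have "(\<lambda>n. inverse (real (Suc n)) * T) \<longlonglongrightarrow> 0 * T"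
          by (intro tendsto_intros LIMSEQ_inverse_real_of_nat)
        then have "(\<lambda>n. inverse (real (Suc (n + m))) * T) \<longlonglongrightarrow> 0"
          using LIMSEQ_ignore_initial_segment[where k = m] by fastforce
        then show "(\<lambda>n. ennreal (inverse (real (Suc (n + m))) * T)) \<longlonglongrightarrow> 0"
          using tendsto_ennrealI[where x = 0] by fastforce
        show "\<forall>\<^sub>F n in sequentially. L1_norm T (f (n + m)) \<le> ennreal (inverse (real (Suc (n + m))) * T)"
          using m by (intro always_eventually allI L1[OF T]) simp
      qed auto
      moreover have "uniform_limit {0..T} (\<lambda>n. Y (n + m)) y sequentially"
        using filterlim_compose[OF lim[OF T] filterlim_add_const_nat_at_top] .
      ultimately show "\<exists>f Y. (\<lambda>n. L1_norm T (f n)) \<longlonglongrightarrow> 0 \<and> (\<forall>n. strong_solution D A F (f n) T (Y n)) \<and>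
          uniform_limit {0..T} Y y sequentially"
        using strong[OF T]
        by (intro exI[of _ "\<lambda>n. f (n + m)"] exI[of _ "\<lambda>n. Y (n + m)"] conjI allI)
    qed (rule \<open>y 0 = y0\<close>)
  qed
qed

end

section \<open>The projection onto the orthogonal complement of the unobservable subspace\<close>

lemma subspace_unobservable:
  assumes "bounded_linear B" "C0_semigroup S"
  shows "subspace (unobservable B S)"
proof -
  have B: "linear B" and S: "\<And>t. 0 \<le> t \<Longrightarrow> linear (S t)"
    using assms by (auto simp: C0_semigroup_def bounded_linear.linear)
  show ?thesis
    unfolding subspace_def unobservable_def
    using linear_0[OF S] linear_0[OF B] linear_add[OF S] linear_add[OF B] linear_scale[OF S] linear_scale[OF B]
    by auto
qed

text \<open>The decomposition is unique, since a vector lying in both \<open>W\<close> and its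
  complement is orthogonal to itself.\<close>

lemma projection_eqI:
  assumes P: "projection_onto_along P (W\<^sup>\<bottom>) W" and W: "subspace W"
    and v: "v \<in> W\<^sup>\<bottom>" and w: "x - v \<in> W"
  shows "P x = v"
proof -
  have "P x - v \<in> W\<^sup>\<bottom>"
    using P v by (intro subspace_diff[OF subspace_orthogonal_comp]) (auto simp: projection_onto_along_def)
  moreover have "P x - v = (x - v) - (x - P x)" by simp
  then have "P x - v \<in> W"
    using P w by (metis subspace_diff[OF W] projection_onto_along_def)
  ultimately have "(P x - v) \<bullet> (P x - v) = 0" by (auto simp: orthogonal_comp_def orthogonal_def)
  then show ?thesis by simp
qed

text \<open>Linearity follows from uniqueness of the decomposition, and the norm bound from
  orthogonality of \<open>P x\<close> and \<open>x - P x\<close>.\<close>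

lemma projection_bounded_linear:
  fixes W :: "'a::real_inner set"
  assumes P: "projection_onto_along P (W\<^sup>\<bottom>) W" and W: "subspace W"
  shows "bounded_linear P" and "norm (P x) \<le> norm x"
proof -
  have V: "P x \<in> W\<^sup>\<bottom>" and PW: "x - P x \<in> W" for x using P by (auto simp: projection_onto_along_def)
  have norm: "norm (P x) \<le> norm x" for x
  proof -
    have "(x - P x) \<bullet> P x = 0"
      using V[of x] PW[of x] by (auto simp: orthogonal_comp_def orthogonal_def)
    then have "P x \<bullet> P x = x \<bullet> P x" by (simp add: inner_diff_left)
    also have "\<dots> \<le> norm x * norm (P x)" by (rule norm_cauchy_schwarz)
    finally have "norm (P x) * norm (P x) \<le> norm x * norm (P x)"
      by (simp add: dot_square_norm power2_eq_square)
    then show ?thesis by (cases "P x = 0") auto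
  qed
  show "norm (P x) \<le> norm x" by (rule norm)
  show "bounded_linear P"
  proof (rule bounded_linear_intro[where K = 1])
    fix x z :: 'a and r :: real
    have "x + z - (P x + P z) = (x - P x) + (z - P z)" by simp
    then have "x + z - (P x + P z) \<in> W" by (metis subspace_add[OF W] PW)
    then show "P (x + z) = P x + P z"
      by (intro projection_eqI[OF P W] subspace_add[OF subspace_orthogonal_comp] V)
    have "r *\<^sub>R x - r *\<^sub>R P x = r *\<^sub>R (x - P x)" by (simp add: scaleR_diff_right)
    then have "r *\<^sub>R x - r *\<^sub>R P x \<in> W" by (metis subspace_scale[OF W] PW)
    then show "P (r *\<^sub>R x) = r *\<^sub>R P x"
      by (intro projection_eqI[OF P W] subspace_scale[OF subspace_orthogonal_comp] V)
  qed (simp add: norm)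
qed

text \<open>\<open>S t\<close> maps \<open>W\<close> into itself by the semigroup law and its
  complement into itself by assumption, so it commutes with \<open>P\<close>. Applying
  \<open>P\<close> to the difference quotient of \<open>x\<close> gives that of
  \<open>P x\<close>.\<close>

lemma (in quasi_contractive_semigroup) projection_domain:
  assumes B: "bounded_linear B" and W_eq: "W = unobservable B S"
    and P: "projection_onto_along P (W\<^sup>\<bottom>) W"
    and invariant: "\<And>t x. 0 \<le> t \<Longrightarrow> x \<in> W\<^sup>\<bottom> \<Longrightarrow> S t x \<in> W\<^sup>\<bottom>"
    and x: "x \<in> D"
  shows "P x \<in> D"
proof -
  have W: "subspace W" unfolding W_eq by (rule subspace_unobservable[OF B C0])
  note P_lin = bounded_linear.linear[OF projection_bounded_linear(1)[OF P W]]
  have commute: "P (S t x) = S t (P x)" if "0 \<le> t" for t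
  proof (rule projection_eqI[OF P W])
    show "S t (P x) \<in> W\<^sup>\<bottom>" using P that invariant by (auto simp: projection_onto_along_def)
    have "x - P x \<in> unobservable B S" using P W_eq by (auto simp: projection_onto_along_def)
    then have "S t (x - P x) \<in> W"
      using that by (simp add: W_eq unobservable_def S_add[symmetric])
    then show "S t x - S t (P x) \<in> W" using linear_diff[OF linear_S[OF that]] by simp
  qed
  have "((\<lambda>t. P ((S t x - x) /\<^sub>R t)) \<longlongrightarrow> P (A x)) (at_right 0)"
    by (rule bounded_linear.tendsto[OF projection_bounded_linear(1)[OF P W] domain_tendsto[OF x]])
  moreover have "P ((S t x - x) /\<^sub>R t) = (S t (P x) - P x) /\<^sub>R t" if "0 < t" for t
    using that by (simp add: linear_scale[OF P_lin] linear_diff[OF P_lin] commute)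
  ultimately have "((\<lambda>t. (S t (P x) - P x) /\<^sub>R t) \<longlongrightarrow> P (A x)) (at_right 0)"
    by (elim Lim_transform_eventually) (auto intro!: eventually_at_rightI[of 0 1])
  then show ?thesis by (rule domainI)
qed

section \<open>The closed-loop feedback as a monotone map plus a Lipschitz map\<close>

theorem theorem3p2:
  fixes D :: "'a::{real_inner, banach} set"
    and A B P :: "'a \<Rightarrow> 'a"
    and S :: "real \<Rightarrow> 'a \<Rightarrow> 'a"
    and \<omega> \<mu> :: real
    and \<phi> :: "'a \<Rightarrow> real"
    and W :: "'a set"
  assumes gen: "generates_quasi_contractive \<omega> D A S"
    and B: "bounded_linear B" "selfadjoint_op B" "positive_op B"
    and W_eq: "W = unobservable B S"
    and P: "projection_onto_along P (W\<^sup>\<bottom>) W"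
    and invariant: "\<forall>t\<ge>0. \<forall>x\<in>W\<^sup>\<bottom>. S t x \<in> W\<^sup>\<bottom>"
    and \<phi>_nonneg: "\<forall>y\<in>W\<^sup>\<bottom> \<inter> D. 0 \<le> \<phi> y"
    and \<phi>_bound: "\<forall>y\<in>W\<^sup>\<bottom> \<inter> D. A y \<bullet> B y \<le> \<phi> y * (norm (B y))\<^sup>2"
    and \<phi>_ext: "\<exists>\<Upsilon> :: 'a \<Rightarrow> 'a. \<exists>L. lipschitz_on L (W\<^sup>\<bottom>) \<Upsilon> \<and> (\<forall>y\<in>W\<^sup>\<bottom> \<inter> D. \<Upsilon> y = \<phi> y *\<^sub>R B y)"
    and \<mu>: "0 < \<mu>" "\<mu> < 1 / 2"
  shows "\<forall>y0. \<exists>y. continuous_on {0..} y \<and>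
           weak_solution D A (closed_loop_F B P \<mu> \<phi>) y0 y \<and>
           (\<forall>z. weak_solution D A (closed_loop_F B P \<mu> \<phi>) y0 z \<longrightarrow> (\<forall>t\<ge>0. z t = y t))"
proof
  fix y0
  \<comment> \<open>A nonnegative type makes the growth factors \<open>exp (\<omega> * t)\<close>
    increasing in time.\<close>
  interpret quasi_contractive_semigroup D A S "max \<omega> 0"
  proof
    show "generates D A S" using gen by (simp add: generates_quasi_contractive_def)
    fix x assume "x \<in> D"
    then have "A x \<bullet> x \<le> \<omega> * (norm x)\<^sup>2" using gen by (simp add: generates_quasi_contractive_def)
    also have "\<dots> \<le> max \<omega> 0 * (norm x)\<^sup>2" by (intro mult_right_mono) auto
    finally show "A x \<bullet> x \<le> max \<omega> 0 * (norm x)\<^sup>2" .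
  qed simp
  interpret positive_operator B
    using B by (rule positive_operator.intro)
  have W: "subspace W" unfolding W_eq by (rule subspace_unobservable[OF B(1) C0])
  have P_V: "P x \<in> W\<^sup>\<bottom>" for x using P by (simp add: projection_onto_along_def)
  \<comment> \<open>The time \<open>t = 0\<close> in the definition of \<open>W\<close> shows that
    \<open>B\<close> vanishes on \<open>W\<close>.\<close>
  have BP: "B (P x) = B x" for x
  proof -
    have "x - P x \<in> unobservable B S" using P W_eq by (auto simp: projection_onto_along_def)
    then have "B (S 0 (x - P x)) = 0" unfolding unobservable_def by blast
    then show ?thesis by (simp add: linear_diff[OF linear_B])
  qed
  obtain \<Upsilon> L where \<Upsilon>: "lipschitz_on L (W\<^sup>\<bottom>) \<Upsilon>" "\<And>y. y \<in> W\<^sup>\<bottom> \<inter> D \<Longrightarrow> \<Upsilon> y = \<phi> y *\<^sub>R B y"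
    using \<phi>_ext by blast
  have L: "0 \<le> L" using \<Upsilon>(1) by (rule lipschitz_on_nonneg)
  have \<Upsilon>_P: "norm (\<Upsilon> (P u) - \<Upsilon> (P v)) \<le> L * norm (u - v)" for u v
  proof -
    have "norm (\<Upsilon> (P u) - \<Upsilon> (P v)) \<le> L * norm (P u - P v)"
      using lipschitz_onD[OF \<Upsilon>(1) P_V P_V] by (simp add: dist_norm)
    also have "P u - P v = P (u - v)"
      using linear_diff[OF bounded_linear.linear[OF projection_bounded_linear(1)[OF P W]]] by simp
    also have "L * norm (P (u - v)) \<le> L * norm (u - v)"
      using L by (intro mult_left_mono projection_bounded_linear(2)[OF P W])
    finally show ?thesis .
  qed
  define F where "F = closed_loop_F B P \<mu> \<phi>"
  define N where "N = radial (cutoff_power (2 * \<mu>) 0)"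
  define G0 where "G0 x = N x + \<Upsilon> (P x)" for x
  \<comment> \<open>In the branch \<open>B (P x) = 0\<close> both summands of \<open>G0 x\<close>
    vanish as well, being multiples of \<open>B x\<close>.\<close>
  have eq: "F x = G0 x" if "x \<in> D" for x
  proof -
    have "P x \<in> W\<^sup>\<bottom> \<inter> D"
      using projection_domain[OF B(1) W_eq P _ that] invariant P_V by blast
    then have "\<Upsilon> (P x) = \<phi> (P x) *\<^sub>R B x" using \<Upsilon>(2) BP by simp
    moreover have "B (P x) \<bullet> P x = B x \<bullet> x"
      using BP form_commute[of x "P x"] by simp
    ultimately show ?thesis
      by (simp add: F_def closed_loop_F_def G0_def N_def radial_power_eq BP)
  qed
  \<comment> \<open>The generator contributes \<open>max \<omega> 0\<close>, the monotone part
    \<open>N\<close> has the favourable sign, and the Lipschitz part contributes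
    \<open>L\<close>.\<close>
  have diss: "((A x - F x) - (A z - F z)) \<bullet> (x - z) \<le> (max \<omega> 0 + L) * (norm (x - z))\<^sup>2"
    if "x \<in> D" "z \<in> D" for x z
  proof -
    have "((A x - F x) - (A z - F z)) \<bullet> (x - z)
        = A (x - z) \<bullet> (x - z) - (N x - N z) \<bullet> (x - z) + (\<Upsilon> (P z) - \<Upsilon> (P x)) \<bullet> (x - z)"
      using that by (simp add: eq G0_def diff_domain inner_diff_left inner_add_left)
    also have "\<dots> \<le> max \<omega> 0 * (norm (x - z))\<^sup>2 - 0 + L * norm (z - x) * norm (x - z)"
      using that \<mu> unfolding N_def
      by (intro add_mono diff_mono dissipative radial_power_monotone
          order_trans[OF norm_cauchy_schwarz mult_right_mono[OF \<Upsilon>_P]]) (auto simp: diff_domain)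
    also have "\<dots> = (max \<omega> 0 + L) * (norm (x - z))\<^sup>2"
      by (simp add: norm_minus_commute power2_eq_square algebra_simps)
    finally show ?thesis .
  qed
  have approx: "\<exists>G L. 0 \<le> L \<and> (\<forall>u v. norm (G u - G v) \<le> L * norm (u - v)) \<and> (\<forall>x. norm (G0 x - G x) \<le> \<eta>)"
    if "0 < \<eta>" for \<eta>
  proof -
    \<comment> \<open>Solves
      \<open>\<epsilon> powr (1 - 2 * \<mu>) = \<eta> / (sqrt_onorm + 1)\<close>, possible as
      \<open>2 * \<mu> < 1\<close>. The part \<open>\<Upsilon> (P x)\<close> cancels in
      \<open>G0 x - G x\<close>, leaving the truncation error.\<close>
    define \<epsilon> where "\<epsilon> = (\<eta> / (sqrt_onorm + 1)) powr (1 / (1 - 2 * \<mu>))"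
    have pos: "0 < \<eta> / (sqrt_onorm + 1)" using that by (simp add: add_nonneg_pos)
    then have "0 < \<epsilon>" by (metis \<epsilon>_def powr_gt_zero less_irrefl)
    have "\<epsilon> powr (1 - 2 * \<mu>) = \<eta> / (sqrt_onorm + 1)"
      using pos \<mu> that by (simp add: \<epsilon>_def powr_powr)
    then have "sqrt_onorm * \<epsilon> powr (1 - 2 * \<mu>) \<le> (sqrt_onorm + 1) * (\<eta> / (sqrt_onorm + 1))"
      using mult_right_mono[of sqrt_onorm "sqrt_onorm + 1", OF _ less_imp_le[OF pos]] by simp
    also have "\<dots> = \<eta>"
    proof -
      have "sqrt_onorm + 1 \<noteq> 0" using sqrt_onorm_nonneg by linarith
      then show ?thesis by simp
    qed
    finally have \<epsilon>: "sqrt_onorm * \<epsilon> powr (1 - 2 * \<mu>) \<le> \<eta>" .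
    define G where "G x = radial (cutoff_power (2 * \<mu>) \<epsilon>) x + \<Upsilon> (P x)" for x
    define M where "M = 2 * \<epsilon> powr - (2 * \<mu>) * sqrt_onorm\<^sup>2"
    have "norm (G u - G v) \<le> (M + L) * norm (u - v)" for u v
    proof -
      have "norm (radial (cutoff_power (2 * \<mu>) \<epsilon>) u - radial (cutoff_power (2 * \<mu>) \<epsilon>) v) \<le> M * norm (u - v)"
        unfolding M_def using \<mu> \<open>0 < \<epsilon>\<close> by (intro radial_cutoff_Lipschitz) auto
      from norm_triangle_mono[OF this \<Upsilon>_P] show ?thesis
        by (simp add: G_def algebra_simps)
    qed
    moreover have "norm (G0 x - G x) \<le> \<eta>" for x
      using radial_cutoff_close[of "2 * \<mu>" \<epsilon> x] \<mu> \<open>0 < \<epsilon>\<close> \<epsilon> by (simp add: G0_def G_def N_def)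
    moreover have "0 \<le> M + L" using L by (simp add: M_def)
    ultimately show ?thesis by blast
  qed
  have K: "0 \<le> max \<omega> 0 + L" using L by simp
  obtain y where y: "continuous_on {0..} y" "weak_solution D A F y0 y"
    using weak_solution_exists[OF diss K eq approx] by blast
  \<comment> \<open>Compared on \<open>[0, t + 1]\<close>, an interval of positive length also for
    \<open>t = 0\<close>.\<close>
  have "z t = y t" if "weak_solution D A F y0 z" "0 \<le> t" for z t
    using y(2) that
    by (intro weak_solution_unique[OF diss K, where T = "t + 1" and ?y0.0 = y0]) (auto simp: weak_solution_def)
  then show "\<exists>y. continuous_on {0..} y \<and> weak_solution D A (closed_loop_F B P \<mu> \<phi>) y0 y \<and>
      (\<forall>z. weak_solution D A (closed_loop_F B P \<mu> \<phi>) y0 z \<longrightarrow> (\<forall>t\<ge>0. z t = y t))"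
    using y unfolding F_def by blast
qed

end
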